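(* Let $r\geq 3$ and let $\mathcal{H}_q$ be the $3$-uniform hypergraph whose vertices are the points of $\mathrm{PG}(r,q)$ and whose hyperedges are the collinear triples of points. There exist absolute constants $c_1,c_2>0$ such that for all sufficiently large $q$ there exist a collection $\mathcal{C}$ of subsets of $V(\mathcal{H}_q)$ and a function $b$ from the power set of $V(\mathcal{H}_q)$ to $\mathcal{C}$ such that: (1) for every independent set $I$ of $\mathcal{H}_q$ there exists $F\subseteq I$ with $I\subseteq b(F)\in\mathcal{C}$ and $|F|\leq c_1q^{(r-1)/2}\ln q$; (2) $e(\mathcal{H}_q[C])\leq 4\begin{bmatrix} r\\1\end{bmatrix}_q^2$ for all $C\in\mathcal{C}$; (3) $\ln|\mathcal{C}|\leq c_2q^{(r-1)/2}\ln^2 q$.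
   Context: An independent set of a hypergraph is a vertex set containing no hyperedge; here these are exactly the caps (sets of points no three collinear) of $\mathrm{PG}(r,q)$. $\mathcal{H}_q[C]$ is the subhypergraph induced on $C$ and $e(\cdot)$ its number of hyperedges. $\begin{bmatrix} r\\1\end{bmatrix}_q=(q^r-1)/(q-1)$. *)

theory Defs
  imports Complex_Main "HOL-Library.FuncSet" "HOL-Algebra.Ring"
begin

record 'v hypergraph =
  vertices :: "'v set"
  hyperedges :: "'v set set"

definition independent_set :: "'v hypergraph \<Rightarrow> 'v set \<Rightarrow> bool" where
  "independent_set H I \<longleftrightarrow> I \<subseteq> vertices H \<and> \<not> (\<exists>e\<in>hyperedges H. e \<subseteq> I)"

definition induced_hypergraph :: "'v hypergraph \<Rightarrow> 'v set \<Rightarrow> 'v hypergraph" where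
  "induced_hypergraph H C =
     \<lparr>vertices = vertices H \<inter> C, hyperedges = {e \<in> hyperedges H. e \<subseteq> C}\<rparr>"

definition num_hyperedges :: "'v hypergraph \<Rightarrow> nat" where
  "num_hyperedges H = card (hyperedges H)"

text \<open>
  The dimension of the projective space has to be a natural number that can be quantified over,
  so the vector space of dimension r + 1 over a field F is carried by the extensional functions
  on the r + 1 indices 0, ..., r with values in the carrier of F.
\<close>

definition coord_space :: "('a, 'm) ring_scheme \<Rightarrow> nat \<Rightarrow> (nat \<Rightarrow> 'a) set" where
  "coord_space F r = {..r} \<rightarrow>\<^sub>E carrier F"

definition span1 :: "('a, 'm) ring_scheme \<Rightarrow> nat \<Rightarrow> (nat \<Rightarrow> 'a) \<Rightarrow> (nat \<Rightarrow> 'a) set" where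
  "span1 F r v = {\<lambda>i\<in>{..r}. a \<otimes>\<^bsub>F\<^esub> v i | a. a \<in> carrier F}"

definition span2 ::
  "('a, 'm) ring_scheme \<Rightarrow> nat \<Rightarrow> (nat \<Rightarrow> 'a) \<Rightarrow> (nat \<Rightarrow> 'a) \<Rightarrow> (nat \<Rightarrow> 'a) set" where
  "span2 F r u v =
     {\<lambda>i\<in>{..r}. (a \<otimes>\<^bsub>F\<^esub> u i) \<oplus>\<^bsub>F\<^esub> (b \<otimes>\<^bsub>F\<^esub> v i) | a b. a \<in> carrier F \<and> b \<in> carrier F}"

definition lin_indep2 ::
  "('a, 'm) ring_scheme \<Rightarrow> nat \<Rightarrow> (nat \<Rightarrow> 'a) \<Rightarrow> (nat \<Rightarrow> 'a) \<Rightarrow> bool" where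
  "lin_indep2 F r u v \<longleftrightarrow>
     (\<forall>a\<in>carrier F. \<forall>b\<in>carrier F.
        (\<forall>i\<le>r. (a \<otimes>\<^bsub>F\<^esub> u i) \<oplus>\<^bsub>F\<^esub> (b \<otimes>\<^bsub>F\<^esub> v i) = \<zero>\<^bsub>F\<^esub>) \<longrightarrow> a = \<zero>\<^bsub>F\<^esub> \<and> b = \<zero>\<^bsub>F\<^esub>)"

text \<open>
  With q the number of elements of F, the points of PG(r,q) are the one-dimensional subspaces of
  the coordinate space. A line is represented by the set of points contained in a
  two-dimensional subspace.
\<close>

definition pg_points :: "('a, 'm) ring_scheme \<Rightarrow> nat \<Rightarrow> (nat \<Rightarrow> 'a) set set" where
  "pg_points F r = {span1 F r v | v. v \<in> coord_space F r \<and> (\<exists>i\<le>r. v i \<noteq> \<zero>\<^bsub>F\<^esub>)}"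

definition pg_lines :: "('a, 'm) ring_scheme \<Rightarrow> nat \<Rightarrow> (nat \<Rightarrow> 'a) set set set" where
  "pg_lines F r =
     {{P \<in> pg_points F r. P \<subseteq> span2 F r u v} | u v.
        u \<in> coord_space F r \<and> v \<in> coord_space F r \<and> lin_indep2 F r u v}"

definition collinear_hypergraph ::
  "('a, 'm) ring_scheme \<Rightarrow> nat \<Rightarrow> (nat \<Rightarrow> 'a) set hypergraph" where
  "collinear_hypergraph F r =
     \<lparr>vertices = pg_points F r,
      hyperedges = {e. e \<subseteq> pg_points F r \<and> card e = 3 \<and> (\<exists>L\<in>pg_lines F r. e \<subseteq> L)}\<rparr>"

text \<open>The Gaussian binomial coefficient with lower index 1.\<close>

definition gauss_binomial_1 :: "nat \<Rightarrow> nat \<Rightarrow> real" where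
  "gauss_binomial_1 q r = (real q ^ r - 1) / (real q - 1)"

end

theory Submission
  imports Defs
begin

text \<open>
  The constants do not depend on r, while the logarithm of the number of small point sets is of
  order r ln q per point. The fingerprints must therefore have o(q^((r-1)/2) ln q) points. This is
  reached in two phases, with \<open>\<theta> = (q^r - 1)/(q - 1)\<close>.

  First, take any T in the cap I with about sqrt(\<theta> ln q) points. By convexity every point t, in C
  or not, is collinear with at least |C|^2/(4 \<theta>) ordered pairs of any set C of at least 4 \<theta>
  points, and these pairs overlap at most twice because T is a cap. One graph container argument on
  the pairs collinear with a point of T then shrinks the whole space to fewer than 4 \<theta> points
  with sqrt(\<theta> ln q) further queries. The same T serves all scales, which is what saves a factor
  sqrt(ln q).

  Second, while C has X > 4 \<theta>^2 ordered collinear triples, a round of the usual 3-uniform container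
  algorithm costs O(\<theta>^(3/2) / sqrt X) queries and reduces X by a constant factor, so the costs form
  a geometric series with sum O(sqrt \<theta>).
\<close>

section \<open>Container maps\<close>

text \<open>The rounds of the second phase alone would be too expensive. A set of m > 4 \<theta>
  points has at least m^3 / (4 \<theta>) ordered collinear triples, so the cost m^(3/2) / sqrt X of
  a round is only known to be of order sqrt \<theta> at each of the roughly ln q scales between q
  \<theta> and 4 \<theta>. The total sqrt \<theta> ln q would put a factor r into the bound for ln
  |\<C>|. Querying T once instead leaves order (\<theta> / |T|) ln q further queries, and |T| = sqrt
  (\<theta> ln q) balances the two. The factor sqrt (ln q) gained in this way absorbs r + 1 as soon
  as (r + 1)^2 \<le> ln q; so the threshold for q depends on r, but no constant does.

  The geometry enters only through counts: two points determine a line, a line has q + 1 points, and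
  there are q \<theta> + 1 points. The container argument is therefore carried out in any linear
  space with these parameters. Triples are ordered so that their number is the sum of the link
  sizes.\<close>

text \<open>The container map f is constant between S and I, so that S is a fingerprint of I. This form of
  the fingerprint property survives adaptive composition, and it lets the algorithms be proved
  correct by induction without ever being written down as programs.\<close>

definition container ::
  "('v set \<Rightarrow> bool) \<Rightarrow> 'v set \<Rightarrow> 'v set \<Rightarrow> ('v set \<Rightarrow> bool) \<Rightarrow> real \<Rightarrow> bool" where
  "container ind T C P k \<longleftrightarrow> (\<exists>f. \<forall>I. ind I \<and> T \<subseteq> I \<and> I \<subseteq> C \<longrightarrow>
     I \<subseteq> f I \<and> f I \<subseteq> C \<and> P (f I) \<and>
     (\<exists>S\<subseteq>I. finite S \<and> real (card S) \<le> k \<and> (\<forall>J. S \<union> T \<subseteq> J \<and> J \<subseteq> I \<longrightarrow> f J = f I)))"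

lemma containerE:
  assumes "container ind T C P k"
  obtains f where
    "\<And>I. ind I \<Longrightarrow> T \<subseteq> I \<Longrightarrow> I \<subseteq> C \<Longrightarrow> I \<subseteq> f I"
    "\<And>I. ind I \<Longrightarrow> T \<subseteq> I \<Longrightarrow> I \<subseteq> C \<Longrightarrow> f I \<subseteq> C"
    "\<And>I. ind I \<Longrightarrow> T \<subseteq> I \<Longrightarrow> I \<subseteq> C \<Longrightarrow> P (f I)"
    "\<And>I. ind I \<Longrightarrow> T \<subseteq> I \<Longrightarrow> I \<subseteq> C \<Longrightarrow>
       \<exists>S\<subseteq>I. finite S \<and> real (card S) \<le> k \<and> (\<forall>J. S \<union> T \<subseteq> J \<and> J \<subseteq> I \<longrightarrow> f J = f I)"
proof -
  from assms obtain f where f: "\<forall>I. ind I \<and> T \<subseteq> I \<and> I \<subseteq> C \<longrightarrow>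
     I \<subseteq> f I \<and> f I \<subseteq> C \<and> P (f I) \<and>
     (\<exists>S\<subseteq>I. finite S \<and> real (card S) \<le> k \<and> (\<forall>J. S \<union> T \<subseteq> J \<and> J \<subseteq> I \<longrightarrow> f J = f I))"
    unfolding container_def by (rule exE)
  show thesis
    by (rule that[of f]; use f in simp)
qed

text \<open>\<open>P C\<close> has to hold only if some independent set lies between
  \<open>T\<close> and \<open>C\<close>. A branch whose answers contradict each other, for example
  because \<open>T\<close> is no longer a cap, is thus closed at no cost.\<close>

lemma container_leaf:
  assumes "\<And>I. ind I \<Longrightarrow> T \<subseteq> I \<Longrightarrow> I \<subseteq> C \<Longrightarrow> P C" and "0 \<le> k"
  shows "container ind T C P k"
  unfolding container_def
  by (rule exI[of _ "\<lambda>_. C"]) (use assms in \<open>auto intro!: exI[of _ "{}"]\<close>)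

text \<open>One question: does \<open>v\<close> belong to \<open>I\<close>? The set \<open>T\<close>
  collects the points answered yes. A yes is recorded in the fingerprint and costs 1. A no is free,
  because every J \<subseteq> I gives the same answer; this is why the fingerprint property compares
  \<open>I\<close> only with its subsets.\<close>

lemma container_query:
  assumes yes: "container ind (insert v T) C1 P k1"
    and no: "container ind T (C - {v}) P k2"
    and sub: "C1 \<subseteq> C" "\<And>I. ind I \<Longrightarrow> insert v T \<subseteq> I \<Longrightarrow> I \<subseteq> C \<Longrightarrow> I \<subseteq> C1"
    and k: "k1 + 1 \<le> k" "k2 \<le> k"
  shows "container ind T C P k"
proof -
  obtain f where f: "\<And>I. ind I \<Longrightarrow> insert v T \<subseteq> I \<Longrightarrow> I \<subseteq> C1 \<Longrightarrow> I \<subseteq> f I"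
    "\<And>I. ind I \<Longrightarrow> insert v T \<subseteq> I \<Longrightarrow> I \<subseteq> C1 \<Longrightarrow> f I \<subseteq> C1"
    "\<And>I. ind I \<Longrightarrow> insert v T \<subseteq> I \<Longrightarrow> I \<subseteq> C1 \<Longrightarrow> P (f I)"
    "\<And>I. ind I \<Longrightarrow> insert v T \<subseteq> I \<Longrightarrow> I \<subseteq> C1 \<Longrightarrow> \<exists>S\<subseteq>I. finite S \<and>
       real (card S) \<le> k1 \<and> (\<forall>J. S \<union> insert v T \<subseteq> J \<and> J \<subseteq> I \<longrightarrow> f J = f I)"
    by (rule containerE[OF yes], rule that)
  obtain g where g: "\<And>I. ind I \<Longrightarrow> T \<subseteq> I \<Longrightarrow> I \<subseteq> C - {v} \<Longrightarrow> I \<subseteq> g I"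
    "\<And>I. ind I \<Longrightarrow> T \<subseteq> I \<Longrightarrow> I \<subseteq> C - {v} \<Longrightarrow> g I \<subseteq> C - {v}"
    "\<And>I. ind I \<Longrightarrow> T \<subseteq> I \<Longrightarrow> I \<subseteq> C - {v} \<Longrightarrow> P (g I)"
    "\<And>I. ind I \<Longrightarrow> T \<subseteq> I \<Longrightarrow> I \<subseteq> C - {v} \<Longrightarrow> \<exists>S\<subseteq>I. finite S \<and>
       real (card S) \<le> k2 \<and> (\<forall>J. S \<union> T \<subseteq> J \<and> J \<subseteq> I \<longrightarrow> g J = g I)"
    by (rule containerE[OF no], rule that)
  define h where "h I = (if v \<in> I then f I else g I)" for I
  have "I \<subseteq> h I \<and> h I \<subseteq> C \<and> P (h I) \<and>
     (\<exists>S\<subseteq>I. finite S \<and> real (card S) \<le> k \<and> (\<forall>J. S \<union> T \<subseteq> J \<and> J \<subseteq> I \<longrightarrow> h J = h I))"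
    if I: "ind I" "T \<subseteq> I" "I \<subseteq> C" for I
  proof (cases "v \<in> I")
    case True
    then have vT: "insert v T \<subseteq> I" using I(2) by simp
    note I' = I(1) vT sub(2)[OF I(1) vT I(3)]
    obtain S where S: "S \<subseteq> I" "finite S" "real (card S) \<le> k1"
      "\<forall>J. S \<union> insert v T \<subseteq> J \<and> J \<subseteq> I \<longrightarrow> f J = f I" using f(4)[OF I'] by (elim exE conjE)
    have "real (card (insert v S)) \<le> k"
      using S(2,3) k(1) by (simp add: card_insert_if)
    moreover have "h J = h I" if "insert v S \<union> T \<subseteq> J" "J \<subseteq> I" for J
      using S(4)[rule_format, of J] that True by (simp add: h_def)
    ultimately have "\<exists>S\<subseteq>I. finite S \<and> real (card S) \<le> k \<and>
        (\<forall>J. S \<union> T \<subseteq> J \<and> J \<subseteq> I \<longrightarrow> h J = h I)"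
      using True S(1,2) by (intro exI[of _ "insert v S"]) simp
    then show ?thesis
      using f(1-3)[OF I'] sub(1) True by (auto simp: h_def)
  next
    case False
    then have I': "ind I" "T \<subseteq> I" "I \<subseteq> C - {v}" using I by auto
    obtain S where S: "S \<subseteq> I" "finite S" "real (card S) \<le> k2"
      "\<forall>J. S \<union> T \<subseteq> J \<and> J \<subseteq> I \<longrightarrow> g J = g I" using g(4)[OF I'] by (elim exE conjE)
    have "h J = h I" if "S \<union> T \<subseteq> J" "J \<subseteq> I" for J
      using S(4)[rule_format, of J] that False by (auto simp: h_def)
    then have "\<exists>S\<subseteq>I. finite S \<and> real (card S) \<le> k \<and>
        (\<forall>J. S \<union> T \<subseteq> J \<and> J \<subseteq> I \<longrightarrow> h J = h I)"
      using S(1-3) k(2) by (intro exI[of _ S]) simp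
    then show ?thesis
      using g(1-3)[OF I'] False by (auto simp: h_def)
  qed
  then show ?thesis
    unfolding container_def by (intro exI[of _ h]) simp
qed

text \<open>Once J contains the first fingerprint, the first map sends J and \<open>I\<close> to the
  same \<open>D\<close>. Both then run the same second map, so the union of the two fingerprints
  works.\<close>

lemma container_bind:
  assumes Q: "container ind T C Q k1"
    and P: "\<And>D. Q D \<Longrightarrow> D \<subseteq> C \<Longrightarrow> container ind {} D P k2"
  shows "container ind T C P (k1 + k2)"
proof -
  obtain f where f: "\<And>I. ind I \<Longrightarrow> T \<subseteq> I \<Longrightarrow> I \<subseteq> C \<Longrightarrow> I \<subseteq> f I"
    "\<And>I. ind I \<Longrightarrow> T \<subseteq> I \<Longrightarrow> I \<subseteq> C \<Longrightarrow> f I \<subseteq> C"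
    "\<And>I. ind I \<Longrightarrow> T \<subseteq> I \<Longrightarrow> I \<subseteq> C \<Longrightarrow> Q (f I)"
    "\<And>I. ind I \<Longrightarrow> T \<subseteq> I \<Longrightarrow> I \<subseteq> C \<Longrightarrow> \<exists>S\<subseteq>I. finite S \<and>
       real (card S) \<le> k1 \<and> (\<forall>J. S \<union> T \<subseteq> J \<and> J \<subseteq> I \<longrightarrow> f J = f I)"
    by (rule containerE[OF Q], rule that)
  \<comment> \<open>A second map is fixed for each \<open>D\<close> in advance, so that its choice
    depends on \<open>I\<close> only through \<open>D\<close>.\<close>
  have "\<forall>D. \<exists>g. Q D \<and> D \<subseteq> C \<longrightarrow> (\<forall>I. ind I \<and> {} \<subseteq> I \<and> I \<subseteq> D \<longrightarrow>
     I \<subseteq> g I \<and> g I \<subseteq> D \<and> P (g I) \<and>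
     (\<exists>S\<subseteq>I. finite S \<and> real (card S) \<le> k2 \<and> (\<forall>J. S \<union> {} \<subseteq> J \<and> J \<subseteq> I \<longrightarrow> g J = g I)))"
  proof
    fix D
    show "\<exists>g. Q D \<and> D \<subseteq> C \<longrightarrow> (\<forall>I. ind I \<and> {} \<subseteq> I \<and> I \<subseteq> D \<longrightarrow>
     I \<subseteq> g I \<and> g I \<subseteq> D \<and> P (g I) \<and>
     (\<exists>S\<subseteq>I. finite S \<and> real (card S) \<le> k2 \<and> (\<forall>J. S \<union> {} \<subseteq> J \<and> J \<subseteq> I \<longrightarrow> g J = g I)))"
      using P[of D] unfolding container_def by (cases "Q D"; cases "D \<subseteq> C") simp_all
  qed
  then obtain g where g: "\<forall>D. Q D \<and> D \<subseteq> C \<longrightarrow> (\<forall>I. ind I \<and> {} \<subseteq> I \<and> I \<subseteq> D \<longrightarrow>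
     I \<subseteq> g D I \<and> g D I \<subseteq> D \<and> P (g D I) \<and>
     (\<exists>S\<subseteq>I. finite S \<and> real (card S) \<le> k2 \<and> (\<forall>J. S \<union> {} \<subseteq> J \<and> J \<subseteq> I \<longrightarrow> g D J = g D I)))"
    by (rule choice[THEN exE])
  define h where "h I = g (f I) I" for I
  have "I \<subseteq> h I \<and> h I \<subseteq> C \<and> P (h I) \<and>
     (\<exists>S\<subseteq>I. finite S \<and> real (card S) \<le> k1 + k2 \<and> (\<forall>J. S \<union> T \<subseteq> J \<and> J \<subseteq> I \<longrightarrow> h J = h I))"
    if I: "ind I" "T \<subseteq> I" "I \<subseteq> C" for I
  proof -
    obtain S where S: "S \<subseteq> I" "finite S" "real (card S) \<le> k1"
      "\<forall>J. S \<union> T \<subseteq> J \<and> J \<subseteq> I \<longrightarrow> f J = f I" using f(4)[OF I] by (elim exE conjE)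
    have gI: "I \<subseteq> g (f I) I \<and> g (f I) I \<subseteq> f I \<and> P (g (f I) I) \<and>
      (\<exists>S\<subseteq>I. finite S \<and> real (card S) \<le> k2 \<and>
        (\<forall>J. S \<union> {} \<subseteq> J \<and> J \<subseteq> I \<longrightarrow> g (f I) J = g (f I) I))"
      using g f(1-3)[OF I] I(1) by simp
    then obtain S' where S': "S' \<subseteq> I" "finite S'" "real (card S') \<le> k2"
      "\<forall>J. S' \<union> {} \<subseteq> J \<and> J \<subseteq> I \<longrightarrow> g (f I) J = g (f I) I"
      by (elim exE conjE)
    have "real (card (S \<union> S')) \<le> k1 + k2"
      using card_Un_le[of S S'] S(3) S'(3) by linarith
    moreover have "h J = h I" if "(S \<union> S') \<union> T \<subseteq> J" "J \<subseteq> I" for J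
      using S(4)[rule_format, of J] S'(4)[rule_format, of J] that by (simp add: h_def)
    ultimately have "\<exists>S\<subseteq>I. finite S \<and> real (card S) \<le> k1 + k2 \<and>
        (\<forall>J. S \<union> T \<subseteq> J \<and> J \<subseteq> I \<longrightarrow> h J = h I)"
      using S(1,2) S'(1,2) by (intro exI[of _ "S \<union> S'"]) simp
    then show ?thesis
      using gI f(2)[OF I] by (auto simp: h_def)
  qed
  then show ?thesis
    unfolding container_def by (intro exI[of _ h]) simp
qed

lemma container_mono:
  assumes cont: "container ind T C P k" and "k \<le> k'" "\<And>D. P D \<Longrightarrow> Q D"
  shows "container ind T C Q k'"
proof -
  obtain f where f: "\<And>I. ind I \<Longrightarrow> T \<subseteq> I \<Longrightarrow> I \<subseteq> C \<Longrightarrow> I \<subseteq> f I"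
    "\<And>I. ind I \<Longrightarrow> T \<subseteq> I \<Longrightarrow> I \<subseteq> C \<Longrightarrow> f I \<subseteq> C"
    "\<And>I. ind I \<Longrightarrow> T \<subseteq> I \<Longrightarrow> I \<subseteq> C \<Longrightarrow> P (f I)"
    "\<And>I. ind I \<Longrightarrow> T \<subseteq> I \<Longrightarrow> I \<subseteq> C \<Longrightarrow> \<exists>S\<subseteq>I. finite S \<and>
       real (card S) \<le> k \<and> (\<forall>J. S \<union> T \<subseteq> J \<and> J \<subseteq> I \<longrightarrow> f J = f I)"
    by (rule containerE[OF cont], rule that)
  have "\<exists>S\<subseteq>I. finite S \<and> real (card S) \<le> k' \<and> (\<forall>J. S \<union> T \<subseteq> J \<and> J \<subseteq> I \<longrightarrow> f J = f I)"
    if I: "ind I" "T \<subseteq> I" "I \<subseteq> C" for I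
  proof -
    obtain S where "S \<subseteq> I" "finite S" "real (card S) \<le> k"
      "\<forall>J. S \<union> T \<subseteq> J \<and> J \<subseteq> I \<longrightarrow> f J = f I" using f(4)[OF I] by (elim exE conjE)
    then show ?thesis using \<open>k \<le> k'\<close> by (intro exI[of _ S]) simp
  qed
  then show ?thesis
    unfolding container_def by (intro exI[of _ f]) (simp add: f(1,2) f(3) assms(3))
qed

text \<open>The Kleitman--Winston argument for the graph G: the potential W drops whenever the queried
  vertex belongs to the independent set, because its neighbours are then discarded.\<close>

lemma graph_container:
  fixes W :: "'v set \<Rightarrow> real"
  assumes fin: "finite C"
    and indep: "\<And>I v w. ind I \<Longrightarrow> T \<subseteq> I \<Longrightarrow> v \<in> I \<Longrightarrow> w \<in> I \<Longrightarrow> (v, w) \<notin> G"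
    and nonneg: "\<And>D. D \<subseteq> C \<Longrightarrow> 0 \<le> W D"
    and mono: "\<And>D E. D \<subseteq> E \<Longrightarrow> E \<subseteq> C \<Longrightarrow> W D \<le> W E"
    and drop: "\<And>D. D \<subseteq> C \<Longrightarrow> \<not> P D \<Longrightarrow> \<exists>v\<in>D. W (D - G `` {v}) + 1 \<le> W D"
  shows "container ind T C P (W C)"
proof -
  have "container ind T' D P (W D)" if "D \<subseteq> C" "T \<subseteq> T'" for D T'
    using that
  proof (induction "card D" arbitrary: D T' rule: less_induct)
    case less
    show ?case
    proof (cases "P D")
      case True
      then show ?thesis using nonneg less.prems by (intro container_leaf) auto
    next
      case False
      then obtain v where v: "v \<in> D" "W (D - G `` {v}) + 1 \<le> W D"
        using drop less.prems by blast
      have "finite D" using less.prems fin finite_subset by blast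
      \<comment> \<open>The drop of \<open>W\<close> forces a neighbour of \<open>v\<close> in
        \<open>D\<close>. So the yes branch shrinks the container too, although \<open>v\<close>
        itself may stay.\<close>
      have "D - G `` {v} \<noteq> D" using v by force
      then have "card (D - G `` {v}) < card D"
        using \<open>finite D\<close> by (intro psubset_card_mono) auto
      then have yes: "container ind (insert v T') (D - G `` {v}) P (W (D - G `` {v}))"
        using less.prems by (intro less.hyps) auto
      have "card (D - {v}) < card D"
        using \<open>finite D\<close> v(1) by (rule card_Diff1_less)
      then have no: "container ind T' (D - {v}) P (W (D - {v}))"
        using less.prems by (intro less.hyps) auto
      show ?thesis
      proof (rule container_query[OF yes no _ _ v(2)])
        show "W (D - {v}) \<le> W D" using less.prems by (intro mono) auto
        show "I \<subseteq> D - G `` {v}" if "ind I" "insert v T' \<subseteq> I" "I \<subseteq> D" for I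
          using indep[of I v] that less.prems by auto
      qed auto
    qed
  qed
  then show ?thesis using order_refl by blast
qed

section \<open>Collinear triples in finite linear spaces\<close>

lemma card_Int_square:
  assumes "finite C"
  shows "card (G \<inter> C \<times> C) = (\<Sum>v\<in>C. card (C \<inter> G `` {v}))"
proof -
  have "G \<inter> C \<times> C = (SIGMA v:C. C \<inter> G `` {v})" by auto
  then show ?thesis using assms by simp
qed

lemma ex_degree_ge_average:
  fixes d :: real
  assumes "finite C" "C \<noteq> {}" "d * card C \<le> card (G \<inter> C \<times> C)"
  shows "\<exists>v\<in>C. d \<le> card (C \<inter> G `` {v})"
proof (rule ccontr)
  assume "\<not> ?thesis"
  then have "(\<Sum>v\<in>C. real (card (C \<inter> G `` {v}))) < (\<Sum>v\<in>C. d)"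
    using assms(1,2) by (intro sum_strict_mono) auto
  then show False
    using assms(3) by (simp add: card_Int_square[OF assms(1)] mult.commute)
qed

text \<open>A Steiner system S(2, q + 1, q \<theta> + 1). The number of points makes \<theta> the
  number of lines through a point, which is (q^r - 1) / (q - 1) in PG(r,q).\<close>

locale finite_linear_space =
  fixes V :: "'v set" and L :: "'v set set" and q \<theta> :: nat
  assumes finite_V: "finite V"
    and line_subset: "l \<in> L \<Longrightarrow> l \<subseteq> V"
    and line_card: "l \<in> L \<Longrightarrow> card l = q + 1"
    and line_through: "u \<in> V \<Longrightarrow> v \<in> V \<Longrightarrow> u \<noteq> v \<Longrightarrow> \<exists>l\<in>L. u \<in> l \<and> v \<in> l"
    and line_unique: "l \<in> L \<Longrightarrow> l' \<in> L \<Longrightarrow> u \<noteq> v \<Longrightarrow> u \<in> l \<Longrightarrow> v \<in> l \<Longrightarrow> u \<in> l' \<Longrightarrow> v \<in> l' \<Longrightarrow> l = l'"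
    and card_V: "card V = q * \<theta> + 1"
    and q_pos: "0 < q"
    and theta_pos: "0 < \<theta>"
begin

definition col :: "'v \<Rightarrow> 'v \<Rightarrow> 'v \<Rightarrow> bool" where
  "col u v w \<longleftrightarrow> u \<noteq> v \<and> u \<noteq> w \<and> v \<noteq> w \<and> (\<exists>l\<in>L. u \<in> l \<and> v \<in> l \<and> w \<in> l)"

definition cap :: "'v set \<Rightarrow> bool" where
  "cap I \<longleftrightarrow> I \<subseteq> V \<and> (\<forall>u\<in>I. \<forall>v\<in>I. \<forall>w\<in>I. \<not> col u v w)"

definition link :: "'v \<Rightarrow> 'v set \<Rightarrow> ('v \<times> 'v) set" where
  "link v A = {(u, w). u \<in> A \<and> w \<in> A \<and> col v u w}"

definition triples :: "'v set \<Rightarrow> ('v \<times> 'v \<times> 'v) set" where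
  "triples A = (SIGMA v:A. link v A)"

lemma finite_line: "l \<in> L \<Longrightarrow> finite l"
  using finite_V line_subset finite_subset by blast

lemma finite_L: "finite L"
  using finite_V line_subset by (intro finite_subset[of L "Pow V"]) auto

lemma col_swap: "col u v w \<Longrightarrow> col v u w" "col u v w \<Longrightarrow> col u w v"
  unfolding col_def by blast+

lemma col_V: "col u v w \<Longrightarrow> u \<in> V \<and> v \<in> V \<and> w \<in> V"
  unfolding col_def using line_subset by blast

lemma link_subset: "link v A \<subseteq> A \<times> A"
  unfolding link_def by auto

lemma link_mono: "A \<subseteq> B \<Longrightarrow> link v A \<subseteq> link v B"
  unfolding link_def by auto

lemma finite_link: "finite A \<Longrightarrow> finite (link v A)"
  using link_subset by (rule finite_subset) auto

lemma finite_triples: "finite A \<Longrightarrow> finite (triples A)"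
  unfolding triples_def by (simp add: finite_link)

lemma card_triples: "finite A \<Longrightarrow> card (triples A) = (\<Sum>v\<in>A. card (link v A))"
  unfolding triples_def by (simp add: finite_link)

lemma card_col_le: "card {w. col u v w} \<le> q"
proof (cases "\<exists>w. col u v w")
  case True
  then obtain l where l: "l \<in> L" "u \<in> l" "v \<in> l" "u \<noteq> v" unfolding col_def by blast
  have "{w. col u v w} \<subseteq> l - {u}"
    using l line_unique unfolding col_def by blast
  then have "card {w. col u v w} \<le> card (l - {u})"
    using finite_line[OF l(1)] by (intro card_mono) auto
  then show ?thesis
    using l line_card[OF l(1)] by simp
qed simp

lemma card_link_le:
  assumes "finite A"
  shows "card (link v A) \<le> card A * q"
proof -
  have "card (link v A) \<le> card (SIGMA u:A. {w. col v u w} \<inter> A)"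
    using assms by (intro card_mono) (auto simp: link_def)
  also have "\<dots> = (\<Sum>u\<in>A. card ({w. col v u w} \<inter> A))"
    using assms by simp
  also have "\<dots> \<le> (\<Sum>u\<in>A. q)"
  proof (rule sum_mono)
    fix u
    have "finite {w. col v u w}"
      by (rule finite_subset[OF _ finite_V]) (blast dest: col_V)
    then have "card ({w. col v u w} \<inter> A) \<le> card {w. col v u w}"
      by (rule card_mono) simp
    then show "card ({w. col v u w} \<inter> A) \<le> q"
      using card_col_le[of v u] by (rule order_trans)
  qed
  finally show ?thesis by simp
qed

lemma card_triples_le:
  assumes "finite A"
  shows "card (triples A) \<le> card A * card A * q"
  using sum_mono[of A "\<lambda>v. card (link v A)" "\<lambda>_. card A * q"] card_link_le[OF assms]
  by (simp add: card_triples[OF assms])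

lemma triples_cap: "cap I \<Longrightarrow> triples I = {}"
  unfolding cap_def triples_def link_def by blast

text \<open>All such \<open>t\<close> lie on the line through \<open>u\<close> and \<open>w\<close>,
  and three of them would be a collinear triple in the cap.\<close>

lemma cap_multiplicity:
  assumes "cap T"
  shows "card {t \<in> T. col t u w} \<le> 2"
proof (rule ccontr)
  assume "\<not> ?thesis"
  then have "3 \<le> card {t \<in> T. col t u w}" by simp
  then obtain A where A: "A \<subseteq> {t \<in> T. col t u w}" "card A = 3"
    by (meson obtain_subset_with_card_n)
  then obtain a b c where abc: "A = {a, b, c}" "a \<noteq> b" "a \<noteq> c" "b \<noteq> c"
    by (auto simp: card_3_iff)
  then have "col a u w" "col b u w" "col c u w" and T: "a \<in> T" "b \<in> T" "c \<in> T"
    using A by auto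
  then have "\<exists>l\<in>L. a \<in> l \<and> b \<in> l \<and> c \<in> l"
    unfolding col_def using line_unique[of _ _ u w] by metis
  then have "col a b c" using abc unfolding col_def by blast
  then show False using assms T unfolding cap_def by blast
qed

text \<open>Double counting of a point of \<open>T\<close> together with an edge collinear with it.
  Links of the points of a cap thus have a union of at least half their total size.\<close>

lemma sum_links_le:
  assumes "cap T" "finite G"
  shows "(\<Sum>t\<in>T. card {(u, w) \<in> G. col t u w}) \<le> 2 * card G"
proof -
  have fT: "finite T" using assms(1) finite_V finite_subset unfolding cap_def by blast
  have "(\<Sum>t\<in>T. card {(u, w) \<in> G. col t u w}) = card (SIGMA t:T. {(u, w) \<in> G. col t u w})"
    using fT assms(2) by (subst card_SigmaI) (auto intro: finite_subset[OF _ assms(2)])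
  also have "\<dots> = card (SIGMA e:G. {t \<in> T. col t (fst e) (snd e)})"
    by (rule bij_betw_same_card[of prod.swap]) (auto simp: bij_betw_def inj_on_def image_iff)
  also have "\<dots> = (\<Sum>e\<in>G. card {t \<in> T. col t (fst e) (snd e)})"
    using fT assms(2) by simp
  also have "\<dots> \<le> (\<Sum>e\<in>G. 2)"
    by (rule sum_mono) (rule cap_multiplicity[OF assms(1)])
  finally show ?thesis by simp
qed

section \<open>The pencil of lines through a point\<close>

lemma lines_meet:
  assumes "l \<in> L" "j \<in> L" "l \<noteq> j" "v \<in> l" "v \<in> j"
  shows "(l - {v}) \<inter> (j - {v}) = {}"
proof (rule equals0I)
  fix x assume "x \<in> (l - {v}) \<inter> (j - {v})"
  then show False using assms line_unique[of l j v x] by auto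
qed

text \<open>The lines through \<open>v\<close> cut disjoint blocks of size q out of the q \<theta>
  other points.\<close>

lemma card_pencil:
  assumes "v \<in> V"
  shows "card {l \<in> L. v \<in> l} \<le> \<theta>"
proof -
  let ?P = "{l \<in> L. v \<in> l}"
  have "\<forall>l\<in>?P. \<forall>j\<in>?P. l \<noteq> j \<longrightarrow> (l - {v}) \<inter> (j - {v}) = {}"
    using lines_meet by simp
  then have "card (\<Union>l\<in>?P. l - {v}) = (\<Sum>l\<in>?P. card (l - {v}))"
    using finite_L finite_line by (intro card_UN_disjoint) auto
  also have "\<dots> = (\<Sum>l\<in>?P. q)"
    by (rule sum.cong) (auto simp: line_card)
  finally have "q * card ?P = card (\<Union>l\<in>?P. l - {v})" by simp
  also have "\<dots> \<le> card (V - {v})"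
    using finite_V line_subset by (intro card_mono) auto
  also have "\<dots> = q * \<theta>" using assms card_V by simp
  finally show ?thesis using q_pos by simp
qed

text \<open>Convexity along the pencil of lines through v. The point v need not lie in C, so every
  point has a dense link in every large set.\<close>

lemma card_link_ge:
  assumes "v \<in> V" "C \<subseteq> V"
  shows "(real (card (C - {v})))\<^sup>2 / \<theta> - card (C - {v}) \<le> card (link v C)"
proof -
  let ?P = "{l \<in> L. v \<in> l}" and ?m = "real (card (C - {v}))"
  have fC: "finite C" using assms(2) finite_V finite_subset by blast
  have un: "(\<Union>l\<in>?P. C \<inter> l - {v}) = C - {v}"
    using line_through[of v] assms by auto
  have disj: "(C \<inter> l - {v}) \<inter> (C \<inter> j - {v}) = {}" if "l \<in> ?P" "j \<in> ?P" "l \<noteq> j" for l j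
    using lines_meet[of l j v] that by fast
  have "(\<Sum>l\<in>?P. card (C \<inter> l - {v})) = card (\<Union>l\<in>?P. C \<inter> l - {v})"
    using finite_L fC disj by (intro card_UN_disjoint[symmetric]) auto
  then have s1: "(\<Sum>l\<in>?P. real (card (C \<inter> l - {v}))) = ?m"
    unfolding un by (metis of_nat_sum)
  have "(\<Sum>l\<in>?P. (card (C \<inter> l - {v}))\<^sup>2) = (\<Sum>l\<in>?P. card ((C \<inter> l - {v}) \<times> (C \<inter> l - {v})))"
    by (simp only: power2_eq_square card_cartesian_product)
  also have "\<dots> = card (\<Union>l\<in>?P. (C \<inter> l - {v}) \<times> (C \<inter> l - {v}))"
    using finite_L fC disj by (intro card_UN_disjoint[symmetric]) fastforce+
  \<comment> \<open>The squares also count the diagonal pairs (u, u), which are in no link. They are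
    the source of the subtracted linear term.\<close>
  also have "\<dots> \<le> card (link v C \<union> (\<lambda>u. (u, u)) ` (C - {v}))"
    using fC finite_link[OF fC] by (intro card_mono) (auto simp: link_def col_def)
  also have "\<dots> \<le> card (link v C) + card (C - {v})"
    using card_Un_le[of "link v C"] card_image_le[of "C - {v}" "\<lambda>u. (u, u)"] fC
    by (metis (no_types, lifting) add_left_mono finite_Diff le_trans)
  finally have s2: "(\<Sum>l\<in>?P. (real (card (C \<inter> l - {v})))\<^sup>2) \<le> card (link v C) + ?m"
    by (metis (mono_tags, lifting) of_nat_add of_nat_le_iff of_nat_power of_nat_sum sum.cong)
  \<comment> \<open>Tangent line x^2 \<ge> 2 c x - c^2 at the mean c = m / \<theta>. Summed over at
    most \<theta> lines it gives 2 c m - \<theta> c^2 = m^2 / \<theta>.\<close>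
  let ?c = "?m / \<theta>"
  have "2 * ?c * ?m - real (card ?P) * ?c\<^sup>2
      = (\<Sum>l\<in>?P. 2 * ?c * card (C \<inter> l - {v}) - ?c\<^sup>2)"
    by (simp only: sum_subtractf sum_distrib_left[symmetric] s1) simp
  also have "\<dots> \<le> (\<Sum>l\<in>?P. (real (card (C \<inter> l - {v})))\<^sup>2)"
  proof (rule sum_mono)
    fix l
    show "2 * ?c * card (C \<inter> l - {v}) - ?c\<^sup>2 \<le> (real (card (C \<inter> l - {v})))\<^sup>2"
      using zero_le_power2[of "?c - card (C \<inter> l - {v})"] by (simp add: power2_diff algebra_simps)
  qed
  also note s2
  finally have "2 * ?c * ?m - real (card ?P) * ?c\<^sup>2 \<le> card (link v C) + ?m" .
  moreover have "real (card ?P) * ?c\<^sup>2 \<le> \<theta> * ?c\<^sup>2"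
    using card_pencil[OF assms(1)] by (intro mult_right_mono) auto
  moreover have "2 * ?c * ?m - \<theta> * ?c\<^sup>2 = ?m\<^sup>2 / \<theta>"
    using theta_pos by (simp add: field_simps power2_eq_square)
  ultimately show ?thesis by linarith
qed

lemma card_link_ge_quarter:
  assumes "v \<in> V" "C \<subseteq> V" "4 * \<theta> \<le> card C"
  shows "(real (card C))\<^sup>2 / (4 * \<theta>) \<le> card (link v C)"
proof -
  define m where "m = real (card C)"
  define x where "x = real (card (C - {v}))"
  have fC: "finite C" using assms(2) finite_V finite_subset by blast
  have m: "4 * \<theta> \<le> m" using assms(3) unfolding m_def by linarith
  have t: "1 \<le> real \<theta>" using theta_pos by simp
  have x: "m - 1 \<le> x"
    using fC unfolding x_def m_def by (cases "v \<in> C") auto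
  \<comment> \<open>Since m / 4 \<ge> \<theta> \<ge> 1, the two factors are at least 3 m / 4 and m /
    2. The factor 4 pays for the point \<open>v\<close> and for the diagonal.\<close>
  have "m\<^sup>2 / 4 \<le> (m - 1) * (m - 1 - \<theta>)"
  proof -
    have "m\<^sup>2 / 4 \<le> (3 * m / 4) * (m / 2)" by (simp add: power2_eq_square)
    also have "\<dots> \<le> (m - 1) * (m - 1 - \<theta>)"
      by (rule mult_mono) (use m t in linarith)+
    finally show ?thesis .
  qed
  also have "\<dots> \<le> x * (x - \<theta>)"
    by (rule mult_mono) (use m t x in linarith)+
  finally have "m\<^sup>2 / 4 / \<theta> \<le> x * (x - \<theta>) / \<theta>"
    by (rule divide_right_mono) simp
  also have "\<dots> = x\<^sup>2 / \<theta> - x"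
    using t by (simp add: field_simps power2_eq_square)
  also have "\<dots> \<le> card (link v C)"
    using card_link_ge[OF assms(1,2)] unfolding x_def by simp
  finally show ?thesis unfolding m_def by simp
qed

section \<open>Collinear triples lost by deleting points\<close>

lemma card_triples_diff:
  assumes "finite C0" "C \<subseteq> C0"
  shows "card (triples C) + (\<Sum>u\<in>C0 - C. card (link u C0)) \<le> card (triples C0)"
proof -
  have "card (triples C) \<le> (\<Sum>u\<in>C. card (link u C0))"
    using assms finite_subset[OF assms(2,1)] finite_link[OF assms(1)]
    by (auto simp: card_triples intro!: sum_mono card_mono link_mono)
  then show ?thesis
    using sum.subset_diff[OF assms(2,1), of "\<lambda>u. card (link u C0)"]
    by (simp add: card_triples[OF assms(1)])
qed

text \<open>A triple that meets \<open>S\<close> has a point of \<open>S\<close> in one of its three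
  positions, and its other two points form an edge of the link of that point. Later \<open>S\<close>
  is the set of saturated points.\<close>

lemma card_triples_split:
  assumes "finite C0" "C \<subseteq> C0"
  shows "card (triples C) \<le> card (triples (C - S)) + 3 * (\<Sum>u\<in>C \<inter> S. card (link u C0))"
proof -
  let ?A = "SIGMA u:C \<inter> S. link u C0"
  have fC: "finite C" using assms finite_subset by blast
  have fA: "finite ?A" using fC finite_link[OF assms(1)] by auto
  have "triples C \<subseteq> triples (C - S) \<union> (?A \<union> (\<lambda>(v, u, w). (u, v, w)) ` ?A \<union> (\<lambda>(w, u, v). (u, v, w)) ` ?A)"
  proof
    fix e assume "e \<in> triples C"
    then obtain u v w where e: "e = (u, v, w)" "u \<in> C" "v \<in> C" "w \<in> C" "col u v w"
      unfolding triples_def link_def by auto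
    then have C0: "u \<in> C0" "v \<in> C0" "w \<in> C0" using assms(2) by auto
    consider "u \<in> S" | "v \<in> S" | "w \<in> S" | "u \<notin> S" "v \<notin> S" "w \<notin> S" by blast
    then show "e \<in> triples (C - S) \<union>
      (?A \<union> (\<lambda>(v, u, w). (u, v, w)) ` ?A \<union> (\<lambda>(w, u, v). (u, v, w)) ` ?A)"
    proof cases
      case 1
      then show ?thesis using e C0 by (auto simp: link_def)
    next
      case 2
      then have "(v, u, w) \<in> ?A" using e C0 col_swap(1)[of u v w] by (simp add: link_def)
      then show ?thesis using e(1) by force
    next
      case 3
      then have "(w, u, v) \<in> ?A"
        using e C0 col_swap(1)[OF col_swap(2)[of u v w]] by (simp add: link_def)
      then show ?thesis using e(1) by force
    next
      case 4
      then show ?thesis using e by (auto simp: triples_def link_def)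
    qed
  qed
  then have "card (triples C) \<le> card (triples (C - S) \<union>
      (?A \<union> (\<lambda>(v, u, w). (u, v, w)) ` ?A \<union> (\<lambda>(w, u, v). (u, v, w)) ` ?A))"
    using fA fC by (intro card_mono) (auto simp: finite_triples)
  also have "\<dots> \<le> card (triples (C - S)) + (card ?A + card ?A + card ?A)"
    by (intro order_trans[OF card_Un_le] add_mono card_image_le fA order_refl)
  also have "card ?A = (\<Sum>u\<in>C \<inter> S. card (link u C0))"
    using fC finite_link[OF assms(1)] by simp
  finally show ?thesis by simp
qed

lemma cap_subset: "cap I \<Longrightarrow> T \<subseteq> I \<Longrightarrow> cap T"
  unfolding cap_def subset_eq by simp

section \<open>Few vertices remain\<close>

text \<open>The graph for the Kleitman-Winston argument: a cap containing \<open>T\<close> spans no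
  edge of it.\<close>

definition secants :: "'v set \<Rightarrow> ('v \<times> 'v) set" where
  "secants T = {(u, w). \<exists>t\<in>T. col t u w}"

lemma cap_secants:
  assumes "cap I" "T \<subseteq> I" "v \<in> I" "w \<in> I"
  shows "(v, w) \<notin> secants T"
  using assms unfolding cap_def secants_def by blast

text \<open>The links of the points of \<open>T\<close> have at least |C|^2 / (4 \<theta>) pairs
  each and cover a pair at most twice. So there are at least |T| |C|^2 / (8 \<theta>) ordered secant
  pairs in \<open>C\<close>, and some point has at least the average degree.\<close>

lemma secants_degree:
  assumes T: "cap T" and C: "C \<subseteq> V" "4 * \<theta> \<le> card C"
  shows "\<exists>v\<in>C. card T * real (card C) / (8 * \<theta>) \<le> card (C \<inter> secants T `` {v})"
proof (rule ex_degree_ge_average)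
  show fC: "finite C" using C(1) finite_V finite_subset by blast
  show "C \<noteq> {}" using C(2) theta_pos by auto
  let ?m = "real (card C)"
  have "card T * (?m\<^sup>2 / (4 * \<theta>)) = (\<Sum>t\<in>T. ?m\<^sup>2 / (4 * \<theta>))" by simp
  also have "\<dots> \<le> (\<Sum>t\<in>T. real (card {(u, w) \<in> secants T \<inter> C \<times> C. col t u w}))"
  proof (rule sum_mono)
    fix t assume t: "t \<in> T"
    then have "{(u, w) \<in> secants T \<inter> C \<times> C. col t u w} = link t C"
      unfolding secants_def link_def by auto
    then show "?m\<^sup>2 / (4 * \<theta>) \<le> card {(u, w) \<in> secants T \<inter> C \<times> C. col t u w}"
      using card_link_ge_quarter[OF _ C] t T unfolding cap_def by auto
  qed
  also have "\<dots> \<le> 2 * card (secants T \<inter> C \<times> C)"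
    using sum_links_le[OF T, of "secants T \<inter> C \<times> C"] fC by (simp flip: of_nat_sum)
  finally show "card T * ?m / (8 * \<theta>) * ?m \<le> card (secants T \<inter> C \<times> C)"
    by (simp add: power2_eq_square field_simps)
qed

text \<open>A yes deletes at least the fraction t / (8 \<theta>) of the container, so about (8
  \<theta> / t) ln (|C| / (4 \<theta>)) of them lead below 4 \<theta> points.\<close>

lemma container_secants:
  fixes t :: real
  assumes T: "T \<subseteq> V" and C: "C \<subseteq> V" and t: "0 < t" "t \<le> card T"
    and k: "0 < card C \<Longrightarrow> 1 + 8 * \<theta> / t * ln (card C / (4 * \<theta>)) \<le> k" "0 \<le> k"
  shows "container cap T C (\<lambda>D. card D < 4 * \<theta>) k"
proof (cases "cap T")
  case False
  have "card C < 4 * \<theta>" if "cap I" "T \<subseteq> I" for I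
    using False cap_subset[OF that] by simp
  then show ?thesis using k(2) by (rule container_leaf)
next
  case True
  \<comment> \<open>The logarithm measured in units of its decrease per query. The summand 1 pays
    for the last query, after which the potential is 0.\<close>
  define W where "W D = (if card D < 4 * \<theta> then 0 else 1 + 8 * \<theta> / t * ln (card D / (4 * \<theta>)))"
    for D :: "'v set"
  have fin: "finite D" if "D \<subseteq> C" for D
    using that C finite_V by (meson finite_subset subset_trans)
  have th: "0 < 4 * real \<theta>" using theta_pos by simp
  have ln0: "0 \<le> 8 * \<theta> / t * ln (card D / (4 * \<theta>))" if "\<not> card D < 4 * \<theta>" for D :: "'v set"
  proof -
    have "4 * real \<theta> \<le> card D" using of_nat_mono[of "4 * \<theta>" "card D"] that by simp
    then show ?thesis using th t(1) by simp
  qed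
  have "container cap T C (\<lambda>D. card D < 4 * \<theta>) (W C)"
  proof (rule graph_container[where G = "secants T"])
    show "finite C" using fin by simp
    show "(v, w) \<notin> secants T" if "cap I" "T \<subseteq> I" "v \<in> I" "w \<in> I" for I v w
      using cap_secants that by blast
    show "0 \<le> W D" if "D \<subseteq> C" for D
      using ln0[of D] by (simp add: W_def)
    show "W D \<le> W E" if "D \<subseteq> E" "E \<subseteq> C" for D E
    proof (cases "card D < 4 * \<theta>")
      case True
      then show ?thesis using ln0[of E] by (simp add: W_def)
    next
      case False
      have DE: "card D \<le> card E" using card_mono[OF fin[OF that(2)] that(1)] .
      have "4 * real \<theta> \<le> card D" using of_nat_mono[of "4 * \<theta>" "card D"] False by simp
      then have "ln (card D / (4 * \<theta>)) \<le> ln (card E / (4 * \<theta>))"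
        using th DE by (intro ln_mono divide_right_mono divide_pos_pos) linarith+
      then have "8 * \<theta> / t * ln (card D / (4 * \<theta>)) \<le> 8 * \<theta> / t * ln (card E / (4 * \<theta>))"
        using t(1) by (intro mult_left_mono) auto
      then show ?thesis using False DE by (simp add: W_def)
    qed
    show "\<exists>v\<in>D. W (D - secants T `` {v}) + 1 \<le> W D" if D: "D \<subseteq> C" "\<not> card D < 4 * \<theta>" for D
    proof -
      let ?m = "real (card D)"
      have "D \<subseteq> V" using D(1) C by blast
      then obtain v where v: "v \<in> D" "card T * ?m / (8 * \<theta>) \<le> card (D \<inter> secants T `` {v})"
        using secants_degree[OF True, of D] D by auto
      let ?D = "D - secants T `` {v}"
      have m: "4 * real \<theta> \<le> ?m" using of_nat_mono[of "4 * \<theta>" "card D"] D(2) by simp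
      have "card (D - D \<inter> secants T `` {v}) = card D - card (D \<inter> secants T `` {v})"
        using fin[OF D(1)] by (intro card_Diff_subset) auto
      moreover have "card (D \<inter> secants T `` {v}) \<le> card D"
        using fin[OF D(1)] by (intro card_mono) auto
      moreover have "D - D \<inter> secants T `` {v} = ?D" by blast
      ultimately have "real (card ?D) = ?m - card (D \<inter> secants T `` {v})"
        by (metis of_nat_diff)
      moreover have "t * ?m / (8 * \<theta>) \<le> card T * ?m / (8 * \<theta>)"
        using t(2) by (intro divide_right_mono mult_right_mono) auto
      ultimately have le: "real (card ?D) \<le> ?m - t * ?m / (8 * \<theta>)" using v(2) by linarith
      have "W ?D + 1 \<le> W D"
      proof (cases "card ?D < 4 * \<theta>")
        case True
        then show ?thesis using ln0[OF D(2)] D(2) by (simp add: W_def)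
      next
        case False
        then have m': "4 * real \<theta> \<le> card ?D"
          using of_nat_mono[of "4 * \<theta>" "card ?D"] by simp
        \<comment> \<open>By ln x \<le> x - 1 the logarithm drops by at least the deleted
          fraction.\<close>
        have "ln (card ?D / (4 * \<theta>)) - ln (?m / (4 * \<theta>)) = ln (card ?D / ?m)"
          using th m m' by (simp add: ln_div)
        also have "\<dots> \<le> card ?D / ?m - 1"
          using th m m' by (intro ln_le_minus_one divide_pos_pos) linarith+
        also have "\<dots> \<le> (?m - t * ?m / (8 * \<theta>)) / ?m - 1"
          using le by (intro diff_right_mono divide_right_mono) auto
        also have "\<dots> = - (t / (8 * \<theta>))"
          using th m by (simp add: field_simps)
        finally have "8 * \<theta> / t * (ln (card ?D / (4 * \<theta>)) - ln (?m / (4 * \<theta>)))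
            \<le> 8 * \<theta> / t * - (t / (8 * \<theta>))"
          using t(1) by (intro mult_left_mono) auto
        also have "\<dots> = -1" using t(1) th by simp
        finally show ?thesis
          using False D(2) by (simp add: W_def right_diff_distrib)
      qed
      then show ?thesis using v(1) by blast
    qed
  qed
  moreover have "W C \<le> k"
    using k theta_pos by (auto simp: W_def)
  ultimately show ?thesis by (rule container_mono)
qed

text \<open>\<open>T\<close> is collected by querying arbitrary points of \<open>C\<close>; refusals
  only shrink \<open>C\<close>. The alternative \<open>triples D = {}\<close> is for caps that are
  exhausted before \<open>t\<close> points have been found.\<close>

lemma container_few_vertices:
  fixes t :: nat and k :: real
  assumes t: "0 < t" and k: "1 + 8 * \<theta> / t * ln (card V / (4 * \<theta>)) \<le> k" "0 \<le> k"
  shows "container cap {} V (\<lambda>D. card D < 4 * \<theta> \<or> triples D = {}) (t + k)"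
proof -
  have "container cap T C (\<lambda>D. card D < 4 * \<theta> \<or> triples D = {}) (real (t - card T) + k)"
    if "C \<subseteq> V" "T \<subseteq> V" "card T \<le> t" for T C
    using that
  proof (induction "card (C - T)" arbitrary: T C rule: less_induct)
    case less
    have fC: "finite C" and fT: "finite T"
      using less.prems(1,2) finite_V by (meson finite_subset)+
    consider "C \<subseteq> T" | "card T = t" | v where "v \<in> C - T" "card T < t"
      using less.prems(3) by fastforce
    then show ?case
    proof cases
      case 1
      \<comment> \<open>Here I \<subseteq> C \<subseteq> T \<subseteq> I, so \<open>C\<close> is
        itself a cap.\<close>
      have "triples C = {}" if "cap I" "T \<subseteq> I" "I \<subseteq> C" for I
      proof -
        have "I = C" using that 1 by blast
        then show ?thesis using that triples_cap by simp
      qed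
      moreover have "0 \<le> real (t - card T) + k" using k(2) by simp
      ultimately show ?thesis by (intro container_leaf) blast+
    next
      case 2
      have "1 + 8 * \<theta> / t * ln (card C / (4 * \<theta>)) \<le> k" if "0 < card C"
      proof -
        have "ln (card C / (4 * \<theta>)) \<le> ln (card V / (4 * \<theta>))"
          using that less.prems(1) theta_pos finite_V
          by (intro ln_mono divide_right_mono divide_pos_pos) (auto intro: card_mono)
        then have "8 * \<theta> / t * ln (card C / (4 * \<theta>)) \<le> 8 * \<theta> / t * ln (card V / (4 * \<theta>))"
          by (intro mult_left_mono) auto
        then show ?thesis using k(1) by linarith
      qed
      then have "container cap T C (\<lambda>D. card D < 4 * \<theta>) k"
        using less.prems 2 t k(2) by (intro container_secants[of T C t]) auto
      then show ?thesis
        by (rule container_mono) (use 2 in auto)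
    next
      case (3 v)
      have "C - insert v T = C - T - {v}" "C - {v} - T = C - T - {v}" by blast+
      then have "card (C - insert v T) < card (C - T)" "card (C - {v} - T) < card (C - T)"
        using card_Diff1_less[of "C - T" v] 3(1) fC by simp_all
      moreover have "card (insert v T) = Suc (card T)"
        using 3(1) fT by simp
      ultimately show ?thesis
        using 3 less.prems
        by (intro container_query[OF less.hyps[of C "insert v T"] less.hyps[of "C - {v}" T]]) auto
    qed
  qed
  from this[of V "{}"] show ?thesis by simp
qed

section \<open>Few collinear triples remain\<close>

text \<open>One round of the hypergraph container algorithm. Points with a large link inside the part of C
  that is not yet saturated are queried, and their links are collected in the graph G until G is
  dense. Since the degree of u in G exceeds a multiple of its degree in the hypergraph by at most q,
  removing half of the edges of G must destroy a proportion of the triples.\<close>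

lemma container_graph_round:
  fixes \<kappa> k :: real
  defines "X \<equiv> \<lambda>C. real (card (triples C))"
  assumes C0: "C0 \<subseteq> V" "C \<subseteq> C0" and \<kappa>: "0 < \<kappa>" "192 * q * card C0 \<le> \<kappa> * X C0" "0 < X C0"
    and G: "G \<subseteq> C0 \<times> C0" "sym G" "\<And>u w. (u, w) \<in> G \<Longrightarrow> \<exists>t\<in>T. col t u w"
    and deg: "\<And>u. u \<in> C0 \<Longrightarrow> card (G `` {u}) \<le> \<kappa> * card (link u C0) + q"
    and dense: "\<kappa> * X C0 / 24 \<le> card G"
    and k: "48 * (card C0)\<^sup>2 / (\<kappa> * X C0) \<le> k"
  shows "container cap T C (\<lambda>D. X D \<le> 191 / 192 * X C0) k"
proof -
  have fC0: "finite C0" using C0(1) finite_V by (rule finite_subset)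
  have fG: "finite G" by (rule finite_subset[OF G(1) finite_cartesian_product[OF fC0 fC0]])
  define m where "m = real (card C0)"
  \<comment> \<open>The mean degree when half of the edges guaranteed by \<open>dense\<close>
    remain. Each yes deletes at least \<Delta> points, so m / \<Delta> queries suffice.\<close>
  define \<Delta> where "\<Delta> = \<kappa> * X C0 / (48 * m)"
  have "C0 \<noteq> {}" using \<kappa>(3) unfolding X_def triples_def by auto
  then have m: "0 < m" using fC0 by (simp add: m_def card_gt_0_iff)
  have \<Delta>: "0 < \<Delta>" using \<kappa> m by (simp add: \<Delta>_def)
  have fin: "finite D" if "D \<subseteq> C" for D
    using that C0(2) fC0 by (meson finite_subset subset_trans)
  have "container cap T C (\<lambda>D. X D \<le> 191 / 192 * X C0) (card C / \<Delta>)"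
  proof (rule graph_container[where G = G and W = "\<lambda>D. card D / \<Delta>"])
    show "finite C" using fin by simp
    show "(v, w) \<notin> G" if "cap I" "T \<subseteq> I" "v \<in> I" "w \<in> I" for I v w
      using G(3)[of v w] that unfolding cap_def by blast
    show "0 \<le> card D / \<Delta>" for D :: "'v set" using \<Delta> by simp
    show "card D / \<Delta> \<le> card E / \<Delta>" if "D \<subseteq> E" "E \<subseteq> C" for D E
      using card_mono[OF fin[OF that(2)] that(1)] \<Delta> by (simp add: divide_right_mono)
    show "\<exists>v\<in>D. card (D - G `` {v}) / \<Delta> + 1 \<le> card D / \<Delta>"
      if D: "D \<subseteq> C" "\<not> X D \<le> 191 / 192 * X C0" for D
    proof -
      have DC0: "D \<subseteq> C0" using D(1) C0(2) by simp
      \<comment> \<open>A lost edge has an end outside \<open>D\<close>. The symmetry of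
        \<open>G\<close> lets this end come first, at the price of a factor 2.\<close>
      have lost: "card (G - D \<times> D) \<le> 2 * (\<Sum>u\<in>C0 - D. card (G `` {u}))"
      proof -
        let ?B = "SIGMA u:C0 - D. G `` {u}"
        have fB: "finite ?B"
          using fC0 fG by (auto intro: finite_Image)
        have "G - D \<times> D \<subseteq> ?B \<union> prod.swap ` ?B"
        proof
          fix e assume e: "e \<in> G - D \<times> D"
          obtain u w where uw: "e = (u, w)" by (cases e)
          have "(w, u) \<in> G" using e uw G(2) by (auto dest: symD)
          then have "(u, w) \<in> ?B \<or> (w, u) \<in> ?B" using e uw G(1) by blast
          then show "e \<in> ?B \<union> prod.swap ` ?B" using uw by force
        qed
        then have "card (G - D \<times> D) \<le> card (?B \<union> prod.swap ` ?B)"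
          using fB by (intro card_mono) auto
        also have "\<dots> \<le> card ?B + card ?B"
          by (intro order_trans[OF card_Un_le] add_mono card_image_le fB order_refl)
        also have "card ?B = (\<Sum>u\<in>C0 - D. card (G `` {u}))"
          using fC0 fG by (simp add: finite_Image)
        finally show ?thesis by simp
      qed
      have "(\<Sum>u\<in>C0 - D. real (card (G `` {u}))) \<le> (\<Sum>u\<in>C0 - D. \<kappa> * card (link u C0) + q)"
        by (rule sum_mono) (simp add: deg)
      also have "\<dots> = \<kappa> * (\<Sum>u\<in>C0 - D. real (card (link u C0))) + card (C0 - D) * real q"
        by (simp add: sum.distrib sum_distrib_left)
      also have "\<dots> \<le> \<kappa> * (X C0 - X D) + m * q"
      proof (intro add_mono mult_left_mono mult_right_mono)
        show "(\<Sum>u\<in>C0 - D. real (card (link u C0))) \<le> X C0 - X D"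
          using card_triples_diff[OF fC0 DC0] unfolding X_def by (simp flip: of_nat_sum)
        show "real (card (C0 - D)) \<le> m"
          unfolding m_def using fC0 by (simp add: card_mono)
      qed (use \<kappa> in auto)
      \<comment> \<open>Origin of 192: both terms are at most \<kappa> X / 192, and twice their sum
        stays below \<kappa> X / 48, half of the bound in \<open>dense\<close>.\<close>
      also have "\<dots> < \<kappa> * X C0 / 96"
      proof -
        have "\<kappa> * (X C0 - X D) < \<kappa> * (X C0 / 192)"
          using D(2) \<kappa>(1) by (intro mult_strict_left_mono) auto
        moreover have "m * q \<le> \<kappa> * X C0 / 192"
          using \<kappa>(2) by (simp add: m_def mult_ac)
        ultimately show ?thesis by simp
      qed
      finally have "real (card (G - D \<times> D)) < \<kappa> * X C0 / 48"
        using lost by (simp flip: of_nat_sum)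
      moreover have "card G = card (G \<inter> D \<times> D) + card (G - D \<times> D)"
        using fG by (metis card_Int_Diff)
      ultimately have "\<kappa> * X C0 / 48 \<le> card (G \<inter> D \<times> D)" using dense by linarith
      moreover have "\<Delta> * card D \<le> \<Delta> * m"
        using DC0 fC0 \<Delta> by (simp add: m_def card_mono)
      moreover have "\<Delta> * m = \<kappa> * X C0 / 48" using m by (simp add: \<Delta>_def)
      ultimately have "\<Delta> * card D \<le> card (G \<inter> D \<times> D)" by linarith
      moreover have "D \<noteq> {}"
        using D(2) \<kappa>(3) by (auto simp: X_def triples_def)
      ultimately obtain v where v: "v \<in> D" "\<Delta> \<le> card (D \<inter> G `` {v})"
        using ex_degree_ge_average[OF fin[OF D(1)]] by blast
      have "card D = card (D \<inter> G `` {v}) + card (D - G `` {v})"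
        using fin[OF D(1)] by (metis card_Int_Diff)
      then have "card (D - G `` {v}) + \<Delta> \<le> card D" using v(2) by linarith
      then have "(card (D - G `` {v}) + \<Delta>) / \<Delta> \<le> card D / \<Delta>"
        using \<Delta> by (intro divide_right_mono) auto
      then show ?thesis using v(1) \<Delta> by (auto simp: add_divide_distrib)
    qed
  qed
  moreover have "card C / \<Delta> \<le> k"
  proof -
    have "card C / \<Delta> \<le> m / \<Delta>"
      using C0(2) fC0 \<Delta> by (intro divide_right_mono) (auto simp: m_def card_mono)
    also have "\<dots> = 48 * m\<^sup>2 / (\<kappa> * X C0)"
      by (simp add: \<Delta>_def power2_eq_square)
    also have "\<dots> \<le> k" using k by (simp add: m_def)
    finally show ?thesis .
  qed
  ultimately show ?thesis by (rule container_mono)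
qed

text \<open>With m points and X triples, each yes of the first stage has a link of at least \<Delta>
  = X / (4 m) pairs in \<open>G\<close>. As \<open>T\<close> is a cap, \<kappa> m of them would give
  at least \<kappa> X / 8 edges, so \<open>G\<close> becomes dense in time and
  \<open>container_graph_round\<close> finishes. The parameter \<kappa> trades the \<kappa> m
  queries of this stage against the 48 m^2 / (\<kappa> X) queries of the second.\<close>

lemma container_round:
  fixes \<kappa> :: real
  defines "X \<equiv> \<lambda>C. real (card (triples C))"
  assumes C0: "C0 \<subseteq> V"
    and \<kappa>: "0 < \<kappa>" "\<kappa> \<le> 1" "192 * q * card C0 \<le> \<kappa> * X C0" "0 < X C0"
  shows "container cap {} C0 (\<lambda>D. X D \<le> 191 / 192 * X C0)
    (\<kappa> * card C0 + 1 + 48 * (card C0)\<^sup>2 / (\<kappa> * X C0))"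
proof -
  define m where "m = real (card C0)"
  define \<Delta> where "\<Delta> = X C0 / (4 * m)"
  define t where "t = nat \<lceil>\<kappa> * m\<rceil>"
  define K where "K = 48 * m\<^sup>2 / (\<kappa> * X C0)"
  \<comment> \<open>The saturated points: their degree in \<open>G\<close> has reached \<kappa>
    times their degree in the hypergraph, and they receive no further edges.\<close>
  define S where "S G = {u. \<kappa> * card (link u C0) \<le> card (G `` {u})}" for G :: "('v \<times> 'v) set"
  let ?P = "\<lambda>D. X D \<le> 191 / 192 * X C0"
  have fC0: "finite C0" using C0 finite_V by (rule finite_subset)
  have "C0 \<noteq> {}" using \<kappa>(4) unfolding X_def triples_def by auto
  then have m: "0 < m" using fC0 by (simp add: m_def card_gt_0_iff)
  have K: "0 \<le> K" using \<kappa> by (simp add: K_def)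
  \<comment> \<open>\<open>G\<close> consists of the links of the points of \<open>T\<close>, each
    taken inside the part that was unsaturated when the point was queried. The last two assumptions
    persist because \<open>G\<close> and its saturated set only grow while \<open>C\<close> only
    shrinks.\<close>
  have "container cap T C ?P (real (t - card T) + K)"
    if "C \<subseteq> C0" "T \<subseteq> C" "card T \<le> t"
      "G \<subseteq> C0 \<times> C0" "sym G" "\<And>u w. (u, w) \<in> G \<Longrightarrow> \<exists>v\<in>T. col v u w"
      "\<And>u. u \<in> C0 \<Longrightarrow> real (card (G `` {u})) \<le> \<kappa> * card (link u C0) + q"
      "\<And>v. v \<in> T \<Longrightarrow> link v (C - S G) \<subseteq> G"
      "\<And>v. v \<in> T \<Longrightarrow> \<Delta> \<le> card {(u, w) \<in> G. col v u w}" for C T G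
    using that
  proof (induction "card (C - T)" arbitrary: C T G rule: less_induct)
    case less
    note C = less.prems(1) and T = less.prems(2,3) and G = less.prems(4-6)
      and deg = less.prems(7) and link_G = less.prems(8) and link_ge = less.prems(9)
    have fC: "finite C" using C fC0 by (rule finite_subset)
    have fT: "finite T" using T(1) fC by (rule finite_subset)
    have fG: "finite G" by (rule finite_subset[OF G(1) finite_cartesian_product[OF fC0 fC0]])
    consider "\<not> cap T" | "X C \<le> X C0 / 2" | "\<kappa> * X C0 / 24 \<le> card G"
      | "cap T" "X C0 / 2 < X C" "card G < \<kappa> * X C0 / 24" by linarith
    then show ?case
    proof cases
      case 1
      have "?P C" if "cap I" "T \<subseteq> I" for I
        using 1 cap_subset[OF that] by simp
      then show ?thesis using K by (intro container_leaf) auto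
    next
      case 2
      then have "?P C" using \<kappa>(4) by simp
      then show ?thesis using K by (intro container_leaf) auto
    next
      case 3
      have "container cap T C ?P K"
        unfolding X_def
        by (rule container_graph_round[OF C0 C \<kappa>(1) _ _ G deg])
          (use \<kappa> 3 in \<open>simp_all add: X_def K_def m_def\<close>)
      then show ?thesis by (rule container_mono) auto
    next
      case 4
      have sumT: "(\<Sum>v\<in>T. real (card {(u, w) \<in> G. col v u w})) \<le> 2 * real (card G)"
        using sum_links_le[OF 4(1) fG] by (simp flip: of_nat_sum)
      have "card T < t"
      proof (rule ccontr)
        assume "\<not> card T < t"
        then have "card T = t" using T(2) by simp
        have "\<kappa> * X C0 / 4 = \<kappa> * m * \<Delta>" using m by (simp add: \<Delta>_def)
        also have "\<dots> \<le> t * \<Delta>"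
          using m \<kappa>(4) by (intro mult_right_mono) (auto simp: t_def \<Delta>_def of_nat_ceiling)
        also have "\<dots> = (\<Sum>v\<in>T. \<Delta>)" using \<open>card T = t\<close> by simp
        also have "\<dots> \<le> 2 * real (card G)"
          using sumT by (rule order_trans[OF sum_mono, rotated]) (rule link_ge)
        finally show False using 4(3) mult_pos_pos[OF \<kappa>(1,4)] by linarith
      qed
      let ?U = "C - S G"
      \<comment> \<open>Otherwise \<open>C\<close> has at most X / 4 triples from the small links
        outside \<open>T\<close>, X / 12 from the links of \<open>T\<close>, which lie in
        \<open>G\<close>, and X / 8 from the saturated points. This is 11/24 of X, less than
        half.\<close>
      have "\<exists>v\<in>C - T. \<Delta> \<le> card (link v ?U)"
      proof (rule ccontr)
        assume "\<not> ?thesis"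
        then have small: "card (link v ?U) \<le> \<Delta>" if "v \<in> C - T" for v
          using that by force
        have "real (card (triples ?U)) = (\<Sum>v\<in>?U. real (card (link v ?U)))"
          using fC by (simp add: card_triples)
        also have "\<dots> \<le> (\<Sum>v\<in>(C - T) \<union> T. real (card (link v ?U)))"
          using fC fT by (intro sum_mono2) auto
        also have "\<dots> = (\<Sum>v\<in>C - T. real (card (link v ?U))) + (\<Sum>v\<in>T. real (card (link v ?U)))"
          using fC fT by (intro sum.union_disjoint) auto
        also have "\<dots> \<le> (\<Sum>v\<in>C - T. \<Delta>) + (\<Sum>v\<in>T. real (card {(u, w) \<in> G. col v u w}))"
        proof (intro add_mono sum_mono)
          fix v assume "v \<in> T"
          then have "link v ?U \<subseteq> {(u, w) \<in> G. col v u w}"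
            using link_G[of v] unfolding link_def by blast
          moreover have "finite {(u, w) \<in> G. col v u w}"
            by (rule finite_subset[OF _ fG]) blast
          ultimately show "real (card (link v ?U)) \<le> card {(u, w) \<in> G. col v u w}"
            by (simp add: card_mono)
        qed (rule small)
        also have "\<dots> \<le> m * \<Delta> + 2 * real (card G)"
        proof -
          have "card (C - T) \<le> card C0" using C fC0 by (intro card_mono) auto
          then have "card (C - T) * \<Delta> \<le> m * \<Delta>"
            using \<kappa>(4) m by (intro mult_right_mono) (auto simp: \<Delta>_def m_def)
          then show ?thesis using sumT by simp
        qed
        finally have U: "real (card (triples ?U)) \<le> X C0 / 4 + 2 * real (card G)"
          using m by (simp add: \<Delta>_def)
        have "\<kappa> * (\<Sum>u\<in>C \<inter> S G. real (card (link u C0))) \<le> (\<Sum>u\<in>C \<inter> S G. real (card (G `` {u})))"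
          unfolding sum_distrib_left by (rule sum_mono) (simp add: S_def)
        also have "\<dots> = card (SIGMA u:C \<inter> S G. G `` {u})"
          using fC fG by (simp add: finite_Image)
        also have "\<dots> \<le> card G"
          using fG by (intro of_nat_mono card_mono) auto
        finally have "\<kappa> * (\<Sum>u\<in>C \<inter> S G. real (card (link u C0))) < \<kappa> * (X C0 / 24)"
          using 4(3) by simp
        then have sat: "(\<Sum>u\<in>C \<inter> S G. real (card (link u C0))) < X C0 / 24"
          using \<kappa>(1) by (simp only: mult_less_cancel_left_pos)
        have "X C \<le> card (triples ?U) + 3 * (\<Sum>u\<in>C \<inter> S G. real (card (link u C0)))"
          using of_nat_mono[OF card_triples_split[OF fC0 C, of "S G"], where 'a = real]
          by (simp add: X_def)
        moreover have "\<kappa> * X C0 \<le> X C0" using \<kappa> by (simp add: mult_left_le_one_le)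
        ultimately show False using 4(2,3) U sat by simp
      qed
      then obtain v where v: "v \<in> C" "v \<notin> T" "\<Delta> \<le> card (link v ?U)" by blast
      have cards: "card (C - insert v T) < card (C - T)" "card (C - {v} - T) < card (C - T)"
      proof -
        have "C - insert v T = C - T - {v}" "C - {v} - T = C - T - {v}" by blast+
        then show "card (C - insert v T) < card (C - T)" "card (C - {v} - T) < card (C - T)"
          using card_Diff1_less[of "C - T" v] v fC by simp_all
      qed
      define G' where "G' = G \<union> link v ?U"
      have fG': "finite G'"
        unfolding G'_def using fG fC by (simp add: finite_link)
      have Im: "card (G `` {u}) \<le> card (G' `` {u})" for u
        unfolding G'_def using fG' by (intro card_mono) (auto simp: G'_def intro: finite_Image)
      then have S: "S G \<subseteq> S G'"
        unfolding S_def by (auto intro: order_trans)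
      \<comment> \<open>In this stage a yes enlarges \<open>T\<close> and \<open>G\<close> but
        leaves the container alone; points are deleted after a yes only in the second stage.\<close>
      have yes: "container cap (insert v T) C ?P (real (t - card (insert v T)) + K)"
      proof (rule less.hyps[OF cards(1) C])
        show "insert v T \<subseteq> C" using T(1) v(1) by simp
        show "card (insert v T) \<le> t" using \<open>card T < t\<close> v(2) fT by simp
        show "G' \<subseteq> C0 \<times> C0" using G(1) C unfolding G'_def link_def by blast
        show "sym G'"
          unfolding G'_def using G(2) by (intro sym_Un) (auto simp: sym_def link_def dest: col_swap(2))
        show "\<exists>v\<in>insert v T. col v u w" if "(u, w) \<in> G'" for u w
          using that G(3)[of u w] unfolding G'_def link_def by blast
        \<comment> \<open>Only an unsaturated point gains edges. Its degree is still below \<kappa>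
          times its link size, and one link adds at most q.\<close>
        show "card (G' `` {u}) \<le> \<kappa> * card (link u C0) + q" if u: "u \<in> C0" for u
        proof (cases "u \<in> ?U")
          case True
          have "G' `` {u} \<subseteq> G `` {u} \<union> {w. col v u w}"
            unfolding G'_def link_def by blast
          moreover have "finite {w. col v u w}"
            by (rule finite_subset[OF _ finite_V]) (blast dest: col_V)
          ultimately have "card (G' `` {u}) \<le> card (G `` {u} \<union> {w. col v u w})"
            using fG by (intro card_mono) (auto simp: finite_Image)
          also have "\<dots> \<le> card (G `` {u}) + q"
            using card_Un_le[of "G `` {u}" "{w. col v u w}"] card_col_le[of v u] by linarith
          finally show ?thesis using True by (simp add: S_def)
        next
          case False
          then have "G' `` {u} = G `` {u}" unfolding G'_def link_def by blast
          then show ?thesis using deg[OF u] by simp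
        qed
        show "link x (C - S G') \<subseteq> G'" if "x \<in> insert v T" for x
          using that link_G[of x] link_mono[of "C - S G'" ?U x] S unfolding G'_def by blast
        show "\<Delta> \<le> card {(u, w) \<in> G'. col x u w}" if "x \<in> insert v T" for x
        proof -
          have fin: "finite {(u, w) \<in> G'. col x u w}"
            by (rule finite_subset[OF _ fG']) blast
          show ?thesis
          proof (cases "x = v")
            case True
            have "card (link v ?U) \<le> card {(u, w) \<in> G'. col x u w}"
              using fin by (rule card_mono) (auto simp: True G'_def link_def)
            then show ?thesis using v(3) by linarith
          next
            case False
            have "card {(u, w) \<in> G. col x u w} \<le> card {(u, w) \<in> G'. col x u w}"
              using fin by (rule card_mono) (auto simp: G'_def)
            then show ?thesis using link_ge[of x] False that by auto
          qed
        qed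
      qed
      have no: "container cap T (C - {v}) ?P (real (t - card T) + K)"
      proof (rule less.hyps[OF cards(2) _ _ T(2) G])
        show "link x (C - {v} - S G) \<subseteq> G" if "x \<in> T" for x
          using link_G[OF that] link_mono[of "C - {v} - S G" ?U x] by blast
      qed (use C T v deg link_ge in auto)
      show ?thesis
        by (rule container_query[OF yes no])
          (use \<open>card T < t\<close> v(2) fT in auto)
    qed
  qed
  from this[of C0 "{}" "{}"] have "container cap {} C0 ?P (real t + K)"
    using \<kappa> by (simp add: sym_def)
  moreover have "real t + K \<le> \<kappa> * card C0 + 1 + 48 * (card C0)\<^sup>2 / (\<kappa> * X C0)"
  proof -
    have "0 \<le> \<kappa> * m" using \<kappa> m by simp
    then have "real t \<le> \<kappa> * m + 1" unfolding t_def by linarith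
    then show ?thesis by (simp add: K_def m_def)
  qed
  ultimately show ?thesis by (rule container_mono)
qed

text \<open>With fewer than 4 \<theta> points and x = sqrt X, a round costs order \<theta>^(3/2) / x
  and multiplies x by at most 399/400. A potential that is affine in 1 / x pays for all rounds,
  which run only while x > 2 \<theta>.\<close>

lemma container_few_triples:
  assumes large: "40000 \<le> \<theta>" "q\<^sup>2 \<le> \<theta>" "16 * q \<le> \<theta>"
    and C: "C \<subseteq> V" "card C < 4 * \<theta> \<or> card (triples C) \<le> 4 * \<theta>\<^sup>2"
  shows "container cap {} C (\<lambda>D. card (triples D) \<le> 4 * \<theta>\<^sup>2) (615600 * sqrt \<theta>)"
proof -
  define s where "s = sqrt \<theta>"
  \<comment> \<open>The constant is 400 times 1539: a round costs at most 1539 s^3 / x, and passing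
    from x to 399 x / 400 raises 1 / x by more than 1 / (400 x).\<close>
  define W where "W x = 615600 * s * (1 - s\<^sup>2 / x)" for x
  let ?P = "\<lambda>D. card (triples D) \<le> 4 * \<theta>\<^sup>2"
  have s2: "s\<^sup>2 = \<theta>" by (simp add: s_def)
  have s: "200 \<le> s"
    unfolding s_def by (rule real_le_rsqrt) (use large(1) in simp)
  have W_mono: "W x \<le> W y" if "0 < x" "x \<le> y" for x y
    using that s by (simp add: W_def frac_le)
  have small: "X \<le> 4 * \<theta>\<^sup>2 \<longleftrightarrow> sqrt X \<le> 2 * s\<^sup>2" for X
  proof -
    have "sqrt ((2 * s\<^sup>2)\<^sup>2) = 2 * s\<^sup>2" by (subst real_sqrt_abs) simp
    then have "sqrt X \<le> 2 * s\<^sup>2 \<longleftrightarrow> sqrt X \<le> sqrt ((2 * s\<^sup>2)\<^sup>2)" by simp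
    also have "\<dots> \<longleftrightarrow> real X \<le> (2 * real \<theta>)\<^sup>2" by (simp only: real_sqrt_le_iff s2)
    also have "\<dots> \<longleftrightarrow> real X \<le> real (4 * \<theta>\<^sup>2)" by (simp add: power_mult_distrib)
    finally show ?thesis by (simp only: of_nat_le_iff)
  qed
  \<comment> \<open>The maximum covers 0 < x < s^2, where \<open>W\<close> is negative but no query
    is made any more.\<close>
  have "container cap {} C ?P (max 0 (W (sqrt (card (triples C)))))"
    if "C \<subseteq> V" "card C < 4 * \<theta> \<or> ?P C" for C
    using that
  proof (induction "card (triples C)" arbitrary: C rule: less_induct)
    case less
    show ?case
    proof (cases "?P C")
      case True
      then show ?thesis by (intro container_leaf) auto
    next
      case False
      have fC: "finite C" using less.prems(1) finite_V by (rule finite_subset)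
      define m where "m = real (card C)"
      define X where "X = real (card (triples C))"
      define x where "x = sqrt X"
      \<comment> \<open>Chosen so that 192 q m \<le> \<kappa> X follows from q \<le> s, m \<le> 4
        s^2 and 2 s^2 < x. The bound \<kappa> \<le> 1 then comes from 384 \<le> 2 s, hence the
        hypothesis \<theta> \<ge> 40000.\<close>
      define \<kappa> where "\<kappa> = 384 * s / x"
      have "card C < 4 * \<theta>" using less.prems(2) False by blast
      then have m: "0 \<le> m" "m \<le> 4 * s\<^sup>2" unfolding s2 m_def by linarith+
      have x: "2 * s\<^sup>2 < x" using False unfolding small x_def X_def by simp
      have "0 < s\<^sup>2" using s by simp
      then have x0: "0 < x" using x by linarith
      have x2: "x\<^sup>2 = X" by (simp add: x_def X_def)
      have X0: "0 < X" using x0 by (simp flip: x2)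
      have q: "real q \<le> s"
        unfolding s_def by (rule real_le_rsqrt) (use large(2) in \<open>simp flip: of_nat_power\<close>)
      have q16: "16 * real q \<le> s\<^sup>2" unfolding s2 using large(3) by linarith
      have \<kappa>X: "\<kappa> * X = 384 * s * x"
        using x0 by (simp add: \<kappa>_def x2[symmetric] power2_eq_square)
      have "container cap {} C (\<lambda>D. real (card (triples D)) \<le> 191 / 192 * X)
          (\<kappa> * card C + 1 + 48 * (card C)\<^sup>2 / (\<kappa> * X))"
        unfolding X_def
      proof (rule container_round[OF less.prems(1)], unfold X_def[symmetric])
        show "0 < \<kappa>" using s x0 by (simp add: \<kappa>_def)
        have "384 * s \<le> 2 * s * s" using s by simp
        then show "\<kappa> \<le> 1" using x x0 by (simp add: \<kappa>_def power2_eq_square)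
        have "q * m \<le> s * (4 * s\<^sup>2)" using q m s by (intro mult_mono) auto
        moreover have "s * (2 * s\<^sup>2) \<le> s * x" using s x by (intro mult_left_mono) auto
        ultimately have "192 * (q * m) \<le> 384 * (s * x)" by linarith
        then show "real (192 * q * card C) \<le> \<kappa> * X"
          unfolding \<kappa>X m_def by (simp add: mult_ac)
        show "0 < X" by (rule X0)
      qed
      then have round: "container cap {} C (\<lambda>D. real (card (triples D)) \<le> 191 / 192 * X)
          (1539 * s ^ 3 / x)"
      proof (rule container_mono)
        have "\<kappa> * m \<le> \<kappa> * (4 * s\<^sup>2)"
          using m s x0 by (intro mult_left_mono) (auto simp: \<kappa>_def)
        also have "\<dots> = 1536 * s ^ 3 / x" by (simp add: \<kappa>_def power2_eq_square power3_eq_cube)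
        finally have 1: "\<kappa> * m \<le> 1536 * s ^ 3 / x" .
        have "48 * m\<^sup>2 / (\<kappa> * X) \<le> 48 * (4 * s\<^sup>2)\<^sup>2 / (\<kappa> * X)"
          unfolding \<kappa>X using m s x0 by (intro divide_right_mono mult_left_mono power_mono) auto
        also have "\<dots> = 2 * s ^ 3 / x"
          unfolding \<kappa>X using s x0 by (simp add: field_simps power2_eq_square power3_eq_cube)
        finally have 2: "48 * m\<^sup>2 / (\<kappa> * X) \<le> 2 * s ^ 3 / x" .
        \<comment> \<open>With 16 q \<le> \<theta> this gives x \<le> s^3, which absorbs the
          rounding term 1 of the round: 1536 + 2 + 1 = 1539.\<close>
        have "X \<le> m * m * q"
          using of_nat_mono[OF card_triples_le[OF fC], where 'a = real] by (simp add: X_def m_def)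
        also have "\<dots> \<le> (4 * s\<^sup>2) * (4 * s\<^sup>2) * (s\<^sup>2 / 16)"
          using m q16 by (intro mult_mono) auto
        also have "\<dots> = (s ^ 3)\<^sup>2" by (simp add: power2_eq_square power3_eq_cube)
        finally have "x \<le> s ^ 3"
          unfolding x_def using s by (intro real_le_lsqrt) auto
        then have 3: "1 \<le> s ^ 3 / x" using x0 by simp
        show "\<kappa> * card C + 1 + 48 * (card C)\<^sup>2 / (\<kappa> * X) \<le> 1539 * s ^ 3 / x"
          using 1 2 3 by (simp add: m_def)
      qed
      \<comment> \<open>The square of 399/400 exceeds 191/192.\<close>
      define y where "y = 399 / 400 * x"
      have y: "0 < y" "s\<^sup>2 \<le> y" using x x0 by (simp_all add: y_def)
      have Wy: "0 \<le> W y" using y s by (simp add: W_def)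
      have "container cap {} C ?P (1539 * s ^ 3 / x + W y)"
      proof (rule container_bind[OF round])
        fix D assume D: "real (card (triples D)) \<le> 191 / 192 * X" "D \<subseteq> C"
        have "D \<subseteq> V" using D(2) less.prems(1) by simp
        have fewer: "card (triples D) < card (triples C)"
          using D(1) X0 unfolding X_def by linarith
        have "card D < 4 * \<theta>"
          using card_mono[OF fC D(2)] \<open>card C < 4 * \<theta>\<close> by linarith
        then have IH: "container cap {} D ?P (max 0 (W (sqrt (card (triples D)))))"
          using less.hyps[OF fewer \<open>D \<subseteq> V\<close>] by blast
        show "container cap {} D ?P (W y)"
        proof (cases "?P D")
          case True
          then show ?thesis using Wy by (intro container_leaf) auto
        next
          case False
          have "real (card (triples D)) \<le> y\<^sup>2"
            using D(1) X0 by (simp add: y_def power_mult_distrib power_divide x2)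
          then have "sqrt (card (triples D)) \<le> y"
            using y by (intro real_le_lsqrt) auto
          moreover have "0 < sqrt (card (triples D))" using False by (auto intro: Nat.gr0I)
          ultimately have "W (sqrt (card (triples D))) \<le> W y" by (intro W_mono)
          then show ?thesis using IH Wy by (elim container_mono) auto
        qed
      qed
      moreover have "1539 * s ^ 3 / x + W y \<le> W x"
        using x0 s by (simp add: W_def y_def field_simps power2_eq_square power3_eq_cube)
      ultimately show ?thesis
        by (elim container_mono) (auto simp: x_def X_def)
    qed
  qed
  from this[OF C] have "container cap {} C ?P (max 0 (W (sqrt (card (triples C)))))" .
  moreover have "max 0 (W (sqrt (card (triples C)))) \<le> 615600 * s"
    using s by (simp add: W_def)
  ultimately show ?thesis
    unfolding s_def by (rule container_mono)
qed

text \<open>Choosing t near sqrt (\<theta> ln q) makes t and (8 \<theta> / t) ln q comparable; their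
  sum has the factor 1 + 8 = 9. Of the final 2, one is the rounding of t and one is the summand 1 in
  the potential of the first phase.\<close>

lemma container_caps:
  assumes large: "40000 \<le> q" "q\<^sup>2 \<le> \<theta>"
  shows "container cap {} V (\<lambda>D. card (triples D) \<le> 4 * \<theta>\<^sup>2)
    (9 * sqrt \<theta> * sqrt (ln q) + 615600 * sqrt \<theta> + 2)"
proof -
  define s where "s = sqrt \<theta>"
  define l where "l = sqrt (ln q)"
  define t where "t = nat \<lceil>s * l\<rceil>"
  let ?P = "\<lambda>D. card (triples D) \<le> 4 * \<theta>\<^sup>2"
  have "0 < ln (real q)" using large(1) by (intro ln_gt_zero) simp
  then have l: "0 < l" "ln (real q) = l\<^sup>2" by (simp_all add: l_def)
  have s: "0 < s" and s8: "real (8 * \<theta>) = 8 * s\<^sup>2" using theta_pos by (simp_all add: s_def)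
  have t_ge: "s * l \<le> t" unfolding t_def by (rule of_nat_ceiling)
  have t_le: "t \<le> s * l + 1"
  proof -
    have "0 \<le> s * l" using s l by simp
    then show ?thesis unfolding t_def by linarith
  qed
  have t: "0 < t" using t_ge s l by (metis mult_pos_pos not_le of_nat_0_less_iff order_less_le_trans)
  have "ln (card V / (4 * \<theta>)) \<le> ln q"
  proof (rule ln_mono)
    show "0 < card V / (4 * \<theta>)"
      using theta_pos card_V by (intro divide_pos_pos) (auto simp: add_pos_nonneg)
    have "1 \<le> q * \<theta>" using theta_pos q_pos by simp
    then have "card V \<le> q * (4 * \<theta>)" using card_V by simp
    then have "real (card V) \<le> q * (4 * \<theta>)" by (simp flip: of_nat_mult of_nat_le_iff)
    then show "card V / (4 * \<theta>) \<le> q" using theta_pos by (simp add: divide_simps)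
  qed
  then have "8 * \<theta> / t * ln (card V / (4 * \<theta>)) \<le> 8 * s\<^sup>2 / t * l\<^sup>2"
    unfolding l(2) s8 by (intro mult_left_mono) auto
  also have "\<dots> \<le> 8 * s\<^sup>2 / (s * l) * l\<^sup>2"
    using s l t_ge by (intro mult_right_mono divide_left_mono) (auto intro: mult_pos_pos simp: t)
  also have "\<dots> = 8 * s * l" using s l by (simp add: power2_eq_square)
  finally have k: "1 + 8 * \<theta> / t * ln (card V / (4 * \<theta>)) \<le> 1 + 8 * s * l" by simp
  have "container cap {} V (\<lambda>D. card D < 4 * \<theta> \<or> triples D = {}) (t + (1 + 8 * s * l))"
    using t k s l by (intro container_few_vertices) auto
  moreover have "container cap {} D ?P (615600 * s)"
    if "card D < 4 * \<theta> \<or> triples D = {}" "D \<subseteq> V" for D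
  proof -
    have "40000 * q \<le> q\<^sup>2" using large(1) by (simp add: power2_eq_square)
    then have "40000 \<le> \<theta>" "16 * q \<le> \<theta>" using large by linarith+
    then show ?thesis
      unfolding s_def using large that by (intro container_few_triples) auto
  qed
  ultimately have "container cap {} V ?P (t + (1 + 8 * s * l) + 615600 * s)"
    by (rule container_bind)
  then show ?thesis
    by (rule container_mono) (use t_le in \<open>simp_all add: s_def l_def\<close>)
qed

end

section \<open>Lines of a finite projective space\<close>

lemma geometric_sum_nat:
  fixes q :: nat
  assumes "1 \<le> q"
  shows "(\<Sum>i<n. q ^ i) * (q - 1) + 1 = q ^ n"
proof (induction n)
  case (Suc n)
  have "(\<Sum>i<Suc n. q ^ i) * (q - 1) + 1 = q ^ n + q ^ n * (q - 1)"
    using Suc by (simp add: add_mult_distrib)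
  also have "\<dots> = q ^ Suc n"
    using assms by (cases q) auto
  finally show ?case .
qed simp

text \<open>A nonempty set of at most k elements is listed and padded with copies of its head to
  length exactly k. The summand 1 is the empty set.\<close>

lemma card_small_subsets:
  assumes "finite V"
  shows "card {S. S \<subseteq> V \<and> card S \<le> k} \<le> 1 + card V ^ k"
proof -
  let ?A = "{xs. set xs \<subseteq> V \<and> length xs = k}"
  have "{S. S \<subseteq> V \<and> card S \<le> k} \<subseteq> insert {} (set ` ?A)"
  proof
    fix S assume S: "S \<in> {S. S \<subseteq> V \<and> card S \<le> k}"
    then have "finite S" using assms finite_subset by auto
    then obtain xs where xs: "set xs = S" "distinct xs"
      using finite_distinct_list by blast
    have len: "length xs \<le> k" using S xs distinct_card by force
    show "S \<in> insert {} (set ` ?A)"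
    proof (cases "S = {}")
      case False
      let ?ys = "xs @ replicate (k - length xs) (hd xs)"
      have "hd xs \<in> S" using False xs(1) by (cases xs) auto
      then have "set ?ys = S" using xs(1) by (auto simp: set_replicate_conv_if)
      moreover have "?ys \<in> ?A" using S len \<open>set ?ys = S\<close> by auto
      ultimately show ?thesis by blast
    qed simp
  qed
  moreover have "finite ?A" using assms by (rule finite_lists_length_eq)
  ultimately have "card {S. S \<subseteq> V \<and> card S \<le> k} \<le> card (insert {} (set ` ?A))"
    by (intro card_mono) auto
  also have "\<dots> \<le> Suc (card (set ` ?A))"
    using \<open>finite ?A\<close> by (simp add: card_insert_if)
  also have "\<dots> \<le> Suc (card ?A)"
    using \<open>finite ?A\<close> by (simp add: card_image_le)
  also have "card ?A = card V ^ k" using assms by (rule card_lists_length_eq)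
  finally show ?thesis by simp
qed

section \<open>Vectors over a finite field\<close>

locale finite_field = field F for F :: "('a, 'm) ring_scheme" (structure) +
  assumes finite_carrier: "finite (carrier F)"
begin

definition zero_vec :: "nat \<Rightarrow> nat \<Rightarrow> 'a" where
  "zero_vec r = (\<lambda>i\<in>{..r}. \<zero>)"

definition smult_vec :: "nat \<Rightarrow> 'a \<Rightarrow> (nat \<Rightarrow> 'a) \<Rightarrow> nat \<Rightarrow> 'a" where
  "smult_vec r a v = (\<lambda>i\<in>{..r}. a \<otimes> v i)"

definition comb :: "nat \<Rightarrow> 'a \<Rightarrow> (nat \<Rightarrow> 'a) \<Rightarrow> 'a \<Rightarrow> (nat \<Rightarrow> 'a) \<Rightarrow> nat \<Rightarrow> 'a" where
  "comb r a u b v = (\<lambda>i\<in>{..r}. (a \<otimes> u i) \<oplus> (b \<otimes> v i))"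

lemma vec_apply [simp]:
  assumes "i \<le> r"
  shows "zero_vec r i = \<zero>" "smult_vec r a v i = a \<otimes> v i"
    "comb r a u b v i = (a \<otimes> u i) \<oplus> (b \<otimes> v i)"
  using assms by (simp_all add: zero_vec_def smult_vec_def comb_def)

lemma coord_carrier [simp]: "v \<in> coord_space F r \<Longrightarrow> i \<le> r \<Longrightarrow> v i \<in> carrier F"
  unfolding coord_space_def by auto

lemma zero_vec_in: "zero_vec r \<in> coord_space F r"
  unfolding coord_space_def zero_vec_def by auto

lemma smult_in: "a \<in> carrier F \<Longrightarrow> v \<in> coord_space F r \<Longrightarrow> smult_vec r a v \<in> coord_space F r"
  unfolding coord_space_def smult_vec_def by auto

lemma comb_in:
  "a \<in> carrier F \<Longrightarrow> b \<in> carrier F \<Longrightarrow> u \<in> coord_space F r \<Longrightarrow> v \<in> coord_space F r \<Longrightarrow>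
    comb r a u b v \<in> coord_space F r"
  unfolding coord_space_def comb_def by auto

lemma coord_eqI:
  "u \<in> coord_space F r \<Longrightarrow> v \<in> coord_space F r \<Longrightarrow> (\<And>i. i \<le> r \<Longrightarrow> u i = v i) \<Longrightarrow> u = v"
  unfolding coord_space_def by (rule PiE_ext) auto

lemma nonzero_iff:
  assumes "v \<in> coord_space F r"
  shows "(\<exists>i\<le>r. v i \<noteq> \<zero>) \<longleftrightarrow> v \<noteq> zero_vec r"
  using coord_eqI[OF assms zero_vec_in] by (metis vec_apply(1))

lemma smult_smult:
  assumes "a \<in> carrier F" "b \<in> carrier F" "v \<in> coord_space F r"
  shows "smult_vec r a (smult_vec r b v) = smult_vec r (a \<otimes> b) v"
  by (rule coord_eqI[OF smult_in[OF assms(1) smult_in[OF assms(2,3)]] smult_in[OF _ assms(3)]])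
    (use assms in \<open>simp_all add: m_assoc\<close>)

lemma smult_one: "v \<in> coord_space F r \<Longrightarrow> smult_vec r \<one> v = v"
  by (rule coord_eqI[OF smult_in]) simp_all

lemma smult_zero: "v \<in> coord_space F r \<Longrightarrow> smult_vec r \<zero> v = zero_vec r"
  by (rule coord_eqI[OF smult_in zero_vec_in]) simp_all

lemma smult_inverse:
  assumes "a \<in> carrier F" "a \<noteq> \<zero>" "v \<in> coord_space F r"
  shows "smult_vec r (inv a) (smult_vec r a v) = v"
proof -
  have "a \<in> Units F" using assms field_Units by blast
  then show ?thesis using assms by (simp add: smult_smult smult_one)
qed

lemma smult_eq_zero:
  assumes "a \<in> carrier F" "v \<in> coord_space F r" "v \<noteq> zero_vec r" "smult_vec r a v = zero_vec r"
  shows "a = \<zero>"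
proof -
  obtain i where i: "i \<le> r" "v i \<noteq> \<zero>" using assms(2,3) nonzero_iff by blast
  have "a \<otimes> v i = \<zero>" using fun_cong[OF assms(4), of i] i by simp
  then show ?thesis using assms(1,2) i integral_iff by simp
qed

section \<open>One-dimensional subspaces and the number of points\<close>

lemma span1_iff: "w \<in> span1 F r v \<longleftrightarrow> (\<exists>a\<in>carrier F. w = smult_vec r a v)"
  unfolding span1_def smult_vec_def by auto

lemma span2_iff:
  "w \<in> span2 F r u v \<longleftrightarrow> (\<exists>a\<in>carrier F. \<exists>b\<in>carrier F. w = comb r a u b v)"
  unfolding span2_def comb_def by auto

lemma span1_subset: "v \<in> coord_space F r \<Longrightarrow> span1 F r v \<subseteq> coord_space F r"
  using smult_in by (auto simp: span1_iff)

lemma span1_self: "v \<in> coord_space F r \<Longrightarrow> v \<in> span1 F r v"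
  using smult_one[of v r] by (auto simp: span1_iff intro!: bexI[of _ \<one>])

lemma span1_least:
  assumes "w \<in> span1 F r v" "v \<in> coord_space F r"
  shows "span1 F r w \<subseteq> span1 F r v"
proof
  fix x assume "x \<in> span1 F r w"
  then obtain a b where "a \<in> carrier F" "b \<in> carrier F" "x = smult_vec r a (smult_vec r b v)"
    using assms(1) by (auto simp: span1_iff)
  then show "x \<in> span1 F r v"
    using smult_smult[of a b v r] assms(2) by (auto simp: span1_iff intro!: bexI[of _ "a \<otimes> b"])
qed

lemma span1_eq:
  assumes "w \<in> span1 F r v" "w \<noteq> zero_vec r" "v \<in> coord_space F r"
  shows "span1 F r w = span1 F r v"
proof
  show "span1 F r w \<subseteq> span1 F r v" using assms(1,3) by (rule span1_least)
  obtain a where a: "a \<in> carrier F" "w = smult_vec r a v"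
    using assms(1) by (auto simp: span1_iff)
  have "a \<noteq> \<zero>" using a(2) assms(2,3) smult_zero by auto
  then have "v = smult_vec r (inv a) w"
    using a assms(3) smult_inverse by simp
  moreover have "inv a \<in> carrier F" using a(1) \<open>a \<noteq> \<zero>\<close> field_Units by blast
  ultimately have "v \<in> span1 F r w" unfolding span1_iff by blast
  moreover have "w \<in> coord_space F r" using a assms(3) smult_in by simp
  ultimately show "span1 F r v \<subseteq> span1 F r w" by (rule span1_least)
qed

lemma point_iff:
  "P \<in> pg_points F r \<longleftrightarrow> (\<exists>v\<in>coord_space F r. v \<noteq> zero_vec r \<and> P = span1 F r v)"
  unfolding pg_points_def using nonzero_iff by blast

lemma point_eq_span1:
  assumes "P \<in> pg_points F r" "w \<in> P" "w \<noteq> zero_vec r"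
  shows "P = span1 F r w"
  using assms span1_eq unfolding point_iff by blast

lemma finite_coord: "finite (coord_space F r)"
  unfolding coord_space_def by (intro finite_PiE) (simp_all add: finite_carrier)

lemma card_coord: "card (coord_space F r) = card (carrier F) ^ (r + 1)"
  unfolding coord_space_def by (simp add: card_PiE)

lemma card_span1:
  assumes "v \<in> coord_space F r" "v \<noteq> zero_vec r"
  shows "card (span1 F r v) = card (carrier F)"
proof -
  obtain i where i: "i \<le> r" "v i \<noteq> \<zero>" using assms nonzero_iff by blast
  have "inj_on (\<lambda>a. smult_vec r a v) (carrier F)"
  proof (rule inj_onI)
    fix a b assume ab: "a \<in> carrier F" "b \<in> carrier F" "smult_vec r a v = smult_vec r b v"
    have "a \<otimes> v i = b \<otimes> v i" using fun_cong[OF ab(3), of i] i by simp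
    then show "a = b" using ab i assms(1) m_rcancel[of "v i" a b] by simp
  qed
  moreover have "span1 F r v = (\<lambda>a. smult_vec r a v) ` carrier F"
    by (auto simp: span1_iff)
  ultimately show ?thesis by (simp add: card_image)
qed

text \<open>The points inside \<open>M\<close> partition its nonzero vectors into classes of size q
  - 1. Asking only for closure under scalars lets one count serve the whole space and the
  two-dimensional subspaces.\<close>

lemma card_points_in_subspace:
  assumes M: "M \<subseteq> coord_space F r" "zero_vec r \<in> M"
    and closed: "\<And>w. w \<in> M \<Longrightarrow> span1 F r w \<subseteq> M"
  shows "card {P \<in> pg_points F r. P \<subseteq> M} * (card (carrier F) - 1) = card M - 1"
proof -
  let ?S = "{P \<in> pg_points F r. P \<subseteq> M}" and ?z = "zero_vec r"
  have fM: "finite M" using M(1) finite_coord by (rule finite_subset)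
  have fS: "finite ?S" using fM by (intro finite_subset[of ?S "Pow M"]) auto
  have "(\<Union>P\<in>?S. P - {?z}) = M - {?z}"
  proof
    show "M - {?z} \<subseteq> (\<Union>P\<in>?S. P - {?z})"
    proof
      fix w assume w: "w \<in> M - {?z}"
      then have "span1 F r w \<in> ?S" "w \<in> span1 F r w - {?z}"
        using M(1) closed[of w] span1_self[of w r] by (auto simp: point_iff)
      then show "w \<in> (\<Union>P\<in>?S. P - {?z})" by blast
    qed
  qed blast
  moreover have "card (\<Union>P\<in>?S. P - {?z}) = (\<Sum>P\<in>?S. card (P - {?z}))"
  proof (rule card_UN_disjoint[OF fS])
    show "\<forall>P\<in>?S. finite (P - {?z})" using fM finite_subset by blast
    show "\<forall>P\<in>?S. \<forall>Q\<in>?S. P \<noteq> Q \<longrightarrow> (P - {?z}) \<inter> (Q - {?z}) = {}"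
    proof (intro ballI impI equals0I)
      fix P Q w
      assume "P \<in> ?S" "Q \<in> ?S" "P \<noteq> Q" "w \<in> (P - {?z}) \<inter> (Q - {?z})"
      then show False
        using point_eq_span1[of P r w] point_eq_span1[of Q r w] by simp
    qed
  qed
  moreover have "(\<Sum>P\<in>?S. card (P - {?z})) = (\<Sum>P\<in>?S. card (carrier F) - 1)"
  proof (rule sum.cong[OF refl])
    fix P assume P: "P \<in> ?S"
    then obtain v where v: "v \<in> coord_space F r" "v \<noteq> ?z" "P = span1 F r v"
      by (auto simp: point_iff)
    have "?z \<in> P"
      using smult_zero[OF v(1)] v(3) by (auto simp: span1_iff intro!: bexI[of _ \<zero>])
    moreover have "finite P" using P fM finite_subset by blast
    ultimately show "card (P - {?z}) = card (carrier F) - 1"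
      using card_span1[OF v(1,2)] v(3) by simp
  qed
  ultimately show ?thesis using fM M(2) by simp
qed

lemma card_carrier_gt_1: "1 < card (carrier F)"
proof -
  have "card {\<zero>, \<one>} \<le> card (carrier F)"
    using finite_carrier by (intro card_mono) auto
  then show ?thesis using one_not_zero by simp
qed

lemma card_points: "card (pg_points F r) = card (carrier F) * (\<Sum>i<r. card (carrier F) ^ i) + 1"
proof -
  let ?q = "card (carrier F)"
  have "{P \<in> pg_points F r. P \<subseteq> coord_space F r} = pg_points F r"
    using span1_subset by (auto simp: point_iff intro: subsetD[OF span1_subset])
  then have "card (pg_points F r) * (?q - 1) = ?q ^ (r + 1) - 1"
    using card_points_in_subspace[OF order_refl zero_vec_in span1_subset, of r] card_coord by simp
  also have "\<dots> = (\<Sum>i<r + 1. ?q ^ i) * (?q - 1)"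
    using geometric_sum_nat[of ?q "r + 1"] card_carrier_gt_1 by simp
  finally have "card (pg_points F r) = (\<Sum>i<r + 1. ?q ^ i)"
    using card_carrier_gt_1 by simp
  also have "\<dots> = ?q * (\<Sum>i<r. ?q ^ i) + 1"
    by (simp only: Suc_eq_plus1[symmetric] sum.lessThan_Suc_shift sum_distrib_left) simp
  finally show ?thesis .
qed

section \<open>Two-dimensional subspaces and lines\<close>

lemma comb_comb:
  assumes "u \<in> coord_space F r" "v \<in> coord_space F r"
    "a \<in> carrier F" "b \<in> carrier F" "c \<in> carrier F" "d \<in> carrier F" "s \<in> carrier F" "t \<in> carrier F"
  shows "comb r s (comb r a u b v) t (comb r c u d v)
    = comb r (s \<otimes> a \<oplus> t \<otimes> c) u (s \<otimes> b \<oplus> t \<otimes> d) v"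
proof (rule coord_eqI)
  fix i assume i: "i \<le> r"
  have [simp]: "u i \<in> carrier F" "v i \<in> carrier F" using assms(1,2) i by simp_all
  show "comb r s (comb r a u b v) t (comb r c u d v) i
      = comb r (s \<otimes> a \<oplus> t \<otimes> c) u (s \<otimes> b \<oplus> t \<otimes> d) v i"
    using assms(3-) i by (simp add: r_distr l_distr m_assoc a_ac)
qed (use assms comb_in in simp_all)

lemma span2_subset:
  "u \<in> coord_space F r \<Longrightarrow> v \<in> coord_space F r \<Longrightarrow> span2 F r u v \<subseteq> coord_space F r"
  using comb_in by (auto simp: span2_iff)

lemma span2_least:
  assumes "u \<in> coord_space F r" "v \<in> coord_space F r" "x \<in> span2 F r u v" "y \<in> span2 F r u v"
  shows "span2 F r x y \<subseteq> span2 F r u v"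
proof
  fix w assume "w \<in> span2 F r x y"
  then obtain s t where st: "s \<in> carrier F" "t \<in> carrier F" "w = comb r s x t y"
    by (auto simp: span2_iff)
  obtain a b where x: "a \<in> carrier F" "b \<in> carrier F" "x = comb r a u b v"
    using assms(3) by (auto simp: span2_iff)
  obtain c d where y: "c \<in> carrier F" "d \<in> carrier F" "y = comb r c u d v"
    using assms(4) by (auto simp: span2_iff)
  have "w = comb r (s \<otimes> a \<oplus> t \<otimes> c) u (s \<otimes> b \<oplus> t \<otimes> d) v"
    unfolding st(3) x(3) y(3) using assms(1,2) x(1,2) y(1,2) st(1,2) by (rule comb_comb)
  moreover have "s \<otimes> a \<oplus> t \<otimes> c \<in> carrier F" "s \<otimes> b \<oplus> t \<otimes> d \<in> carrier F"
    using x y st by simp_all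
  ultimately show "w \<in> span2 F r u v" unfolding span2_iff by blast
qed

lemma span1_subset_span2:
  assumes "u \<in> coord_space F r" "v \<in> coord_space F r"
  shows "span1 F r u \<subseteq> span2 F r u v" "span1 F r v \<subseteq> span2 F r u v"
proof -
  have "smult_vec r a u = comb r a u \<zero> v" "smult_vec r a v = comb r \<zero> u a v"
    if "a \<in> carrier F" for a
    using assms that by (auto intro!: coord_eqI[OF smult_in comb_in])
  then show "span1 F r u \<subseteq> span2 F r u v" "span1 F r v \<subseteq> span2 F r u v"
    unfolding subset_iff span1_iff span2_iff by (metis zero_closed)+
qed

lemma span2_closed:
  assumes "u \<in> coord_space F r" "v \<in> coord_space F r" "w \<in> span2 F r u v"
  shows "span1 F r w \<subseteq> span2 F r u v"
proof -
  have "w \<in> coord_space F r" using assms span2_subset by blast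
  then show ?thesis
    using span1_subset_span2(1)[of w r w] span2_least[OF assms(1,2,3,3)] by blast
qed

lemma card_span2:
  assumes uv: "u \<in> coord_space F r" "v \<in> coord_space F r" and li: "lin_indep2 F r u v"
  shows "card (span2 F r u v) = (card (carrier F))\<^sup>2"
proof -
  have "inj_on (\<lambda>(a, b). comb r a u b v) (carrier F \<times> carrier F)"
  proof (rule inj_onI, clarify)
    fix a b c d
    assume abcd: "a \<in> carrier F" "b \<in> carrier F" "c \<in> carrier F" "d \<in> carrier F"
      and eq: "comb r a u b v = comb r c u d v"
    have "(a \<ominus> c) \<otimes> u i \<oplus> (b \<ominus> d) \<otimes> v i = \<zero>" if i: "i \<le> r" for i
    proof -
      have [simp]: "u i \<in> carrier F" "v i \<in> carrier F" using uv i by simp_all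
      have "a \<otimes> u i \<oplus> b \<otimes> v i = c \<otimes> u i \<oplus> d \<otimes> v i"
        using fun_cong[OF eq, of i] i by simp
      then have "(a \<otimes> u i \<oplus> b \<otimes> v i) \<ominus> (c \<otimes> u i \<oplus> d \<otimes> v i) = \<zero>"
        using abcd by (simp add: minus_eq r_neg)
      then show ?thesis
        using abcd by (simp add: minus_eq l_distr l_minus minus_add a_ac)
    qed
    then have "a \<ominus> c = \<zero>" "b \<ominus> d = \<zero>"
      using li abcd unfolding lin_indep2_def by auto
    then show "a = c \<and> b = d" 
      using abcd sum_zero_eq_neg[of a "\<ominus> c"] sum_zero_eq_neg[of b "\<ominus> d"]
      by (simp add: minus_eq)
  qed
  moreover have "span2 F r u v = (\<lambda>(a, b). comb r a u b v) ` (carrier F \<times> carrier F)"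
    by (force simp: span2_iff image_iff)
  ultimately show ?thesis by (simp add: card_image card_cartesian_product power2_eq_square)
qed

lemma pg_line_subset: "l \<in> pg_lines F r \<Longrightarrow> l \<subseteq> pg_points F r"
  unfolding pg_lines_def by auto

lemma card_pg_line:
  assumes "l \<in> pg_lines F r"
  shows "card l = card (carrier F) + 1"
proof -
  let ?q = "card (carrier F)"
  obtain u v where uv: "u \<in> coord_space F r" "v \<in> coord_space F r" "lin_indep2 F r u v"
    and l: "l = {P \<in> pg_points F r. P \<subseteq> span2 F r u v}"
    using assms unfolding pg_lines_def by blast
  have "zero_vec r = comb r \<zero> u \<zero> v"
    using uv by (intro coord_eqI[OF zero_vec_in comb_in]) simp_all
  then have "zero_vec r \<in> span2 F r u v" unfolding span2_iff by blast
  then have "card l * (?q - 1) = ?q\<^sup>2 - 1"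
    using card_points_in_subspace[OF span2_subset[OF uv(1,2)] _ span2_closed[OF uv(1,2)]]
      card_span2[OF uv] l by simp
  also have "\<dots> = (?q + 1) * (?q - 1)"
    using card_carrier_gt_1 by (cases ?q) (simp_all add: power2_eq_square)
  finally show ?thesis using card_carrier_gt_1 unfolding mult_cancel2 by simp
qed

text \<open>A relation with a \<noteq> 0 makes \<open>u\<close> a multiple of \<open>v\<close>, so
  that the two points coincide; with a = 0 it forces b = 0 because \<open>v\<close> is
  nonzero.\<close>

lemma lin_indep2_points:
  assumes "u \<in> coord_space F r" "v \<in> coord_space F r" "u \<noteq> zero_vec r" "v \<noteq> zero_vec r"
    and "span1 F r u \<noteq> span1 F r v"
  shows "lin_indep2 F r u v"
  unfolding lin_indep2_def
proof (intro ballI impI)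
  fix a b assume ab: "a \<in> carrier F" "b \<in> carrier F" "\<forall>i\<le>r. a \<otimes> u i \<oplus> b \<otimes> v i = \<zero>"
  have au: "smult_vec r a u = smult_vec r (\<ominus> b) v"
  proof (rule coord_eqI)
    fix i assume i: "i \<le> r"
    then have "a \<otimes> u i \<oplus> b \<otimes> v i = \<zero>" "u i \<in> carrier F" "v i \<in> carrier F"
      using ab(3) assms(1,2) by simp_all
    then show "smult_vec r a u i = smult_vec r (\<ominus> b) v i"
      using ab(1,2) i by (simp add: l_minus sum_zero_eq_neg)
  qed (use ab(1,2) assms(1,2) smult_in in simp_all)
  have "a = \<zero>"
  proof (rule ccontr)
    assume a: "a \<noteq> \<zero>"
    then have inv: "inv a \<in> carrier F" using ab(1) field_Units by blast
    have "u = smult_vec r (inv a) (smult_vec r (\<ominus> b) v)"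
      using smult_inverse[OF ab(1) a assms(1)] au by simp
    also have "\<dots> = smult_vec r (inv a \<otimes> \<ominus> b) v"
      using inv ab(2) assms(2) by (intro smult_smult) auto
    finally have "u \<in> span1 F r v"
      unfolding span1_iff using inv ab(2) by blast
    then show False using span1_eq assms by blast
  qed
  then have "smult_vec r (\<ominus> b) v = zero_vec r"
    using au smult_zero[OF assms(1)] by simp
  then have "\<ominus> b = \<zero>" using ab(2) assms(2,4) by (intro smult_eq_zero[of "\<ominus> b" v r]) auto
  then show "a = \<zero> \<and> b = \<zero>" using \<open>a = \<zero>\<close> ab(2) by simp
qed

lemma ex_pg_line:
  assumes "P \<in> pg_points F r" "Q \<in> pg_points F r" "P \<noteq> Q"
  shows "\<exists>l\<in>pg_lines F r. P \<in> l \<and> Q \<in> l"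
proof -
  obtain u where u: "u \<in> coord_space F r" "u \<noteq> zero_vec r" "P = span1 F r u"
    using assms(1) by (auto simp: point_iff)
  obtain v where v: "v \<in> coord_space F r" "v \<noteq> zero_vec r" "Q = span1 F r v"
    using assms(2) by (auto simp: point_iff)
  have "lin_indep2 F r u v" using u v assms(3) by (intro lin_indep2_points) auto
  then have "{X \<in> pg_points F r. X \<subseteq> span2 F r u v} \<in> pg_lines F r"
    unfolding pg_lines_def using u v by blast
  moreover have "P \<in> {X \<in> pg_points F r. X \<subseteq> span2 F r u v}" "Q \<in> {X \<in> pg_points F r. X \<subseteq> span2 F r u v}"
    using assms(1,2) span1_subset_span2[OF u(1) v(1)] by (simp_all add: u(3) v(3))
  ultimately show ?thesis by (intro bexI conjI)
qed

text \<open>Counting replaces dimension theory: the span of representatives of the two points lies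
  in the plane of vectors of every line through them, and both have q^2 elements.\<close>

lemma pg_line_unique:
  assumes "l \<in> pg_lines F r" "l' \<in> pg_lines F r" "P \<noteq> Q"
    and "P \<in> l" "Q \<in> l" "P \<in> l'" "Q \<in> l'"
  shows "l = l'"
proof -
  have PQ: "P \<in> pg_points F r" "Q \<in> pg_points F r"
    using subsetD[OF pg_line_subset[OF assms(1)]] assms(4,5) by simp_all
  obtain x where x: "x \<in> coord_space F r" "x \<noteq> zero_vec r" "P = span1 F r x"
    using PQ(1) by (auto simp: point_iff)
  obtain y where y: "y \<in> coord_space F r" "y \<noteq> zero_vec r" "Q = span1 F r y"
    using PQ(2) by (auto simp: point_iff)
  have li: "lin_indep2 F r x y" using x y assms(3) by (intro lin_indep2_points) auto
  have "m = {X \<in> pg_points F r. X \<subseteq> span2 F r x y}"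
    if m: "m \<in> pg_lines F r" "P \<in> m" "Q \<in> m" for m
  proof -
    obtain u v where uv: "u \<in> coord_space F r" "v \<in> coord_space F r" "lin_indep2 F r u v"
      and l: "m = {X \<in> pg_points F r. X \<subseteq> span2 F r u v}"
      using m(1) unfolding pg_lines_def by blast
    have "x \<in> span2 F r u v" "y \<in> span2 F r u v"
      using m(2,3) l x y span1_self by auto
    then have "span2 F r x y \<subseteq> span2 F r u v"
      by (rule span2_least[OF uv(1,2)])
    moreover have "finite (span2 F r u v)"
      using span2_subset[OF uv(1,2)] finite_coord by (rule finite_subset)
    moreover have "card (span2 F r x y) = card (span2 F r u v)"
      using card_span2[OF x(1) y(1) li] card_span2[OF uv] by simp
    ultimately have "span2 F r x y = span2 F r u v" by (metis card_subset_eq)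
    then show ?thesis using l by simp
  qed
  from this[of l] this[of l'] assms show ?thesis by simp
qed

section \<open>Containers for caps\<close>

lemma finite_linear_space_pg:
  assumes "0 < r"
  shows "finite_linear_space (pg_points F r) (pg_lines F r) (card (carrier F)) (\<Sum>i<r. card (carrier F) ^ i)"
proof
  show "finite (pg_points F r)" using card_points[of r] card_ge_0_finite[of "pg_points F r"] by simp
  show "0 < (\<Sum>i<r. card (carrier F) ^ i)"
    using assms card_carrier_gt_1 by (intro sum_pos) auto
qed (use card_points card_carrier_gt_1 pg_line_subset card_pg_line ex_pg_line pg_line_unique in auto)

lemma gauss_binomial_1_eq: "gauss_binomial_1 (card (carrier F)) r = real (\<Sum>i<r. card (carrier F) ^ i)"
proof -
  let ?q = "card (carrier F)"
  have "real ((\<Sum>i<r. ?q ^ i) * (?q - 1) + 1) = real (?q ^ r)"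
    using geometric_sum_nat[of ?q r] card_carrier_gt_1 by simp
  then have "real (\<Sum>i<r. ?q ^ i) * (real ?q - 1) = real ?q ^ r - 1"
    using card_carrier_gt_1 by (simp add: of_nat_diff)
  then show ?thesis
    using card_carrier_gt_1 unfolding gauss_binomial_1_def
    by (intro divide_eq_imp[THEN sym, THEN sym]) auto
qed

text \<open>The constant is 2 times 615612: the fingerprint bound plus 1 is at most (9 + 615600 + 3)
  sqrt \<theta> sqrt (ln q), and sqrt \<theta> \<le> 2 q^((r-1)/2).\<close>

lemma containers_collinear:
  fixes r :: nat
  defines "q \<equiv> card (carrier F)" and "H \<equiv> collinear_hypergraph F r" and "c \<equiv> 1231224 :: real"
  assumes r: "3 \<le> r" and q: "40000 \<le> q" "(real r + 1)\<^sup>2 \<le> ln q"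
  shows "\<exists>\<C> \<subseteq> Pow (vertices H). \<exists>b \<in> Pow (vertices H) \<rightarrow> \<C>.
    (\<forall>I. independent_set H I \<longrightarrow>
       (\<exists>S\<subseteq>I. I \<subseteq> b S \<and> b S \<in> \<C> \<and>
          real (card S) \<le> c * real q powr ((real r - 1) / 2) * ln (real q))) \<and>
    (\<forall>C\<in>\<C>. real (num_hyperedges (induced_hypergraph H C)) \<le> 4 * (gauss_binomial_1 q r)\<^sup>2) \<and>
    ln (real (card \<C>)) \<le> c * real q powr ((real r - 1) / 2) * (ln (real q))\<^sup>2"
proof -
  define \<theta> where "\<theta> = (\<Sum>i<r. q ^ i)"
  interpret finite_linear_space "pg_points F r" "pg_lines F r" q \<theta>
    unfolding q_def \<theta>_def using r by (intro finite_linear_space_pg) simp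
  let ?V = "pg_points F r"
  define s where "s = sqrt \<theta>"
  define l where "l = sqrt (ln q)"
  define Q where "Q = real q powr ((real r - 1) / 2)"
  define K where "K = 9 * s * l + 615600 * s + 2"
  define k where "k = nat \<lfloor>K\<rfloor>"
  have V: "vertices H = ?V" by (simp add: H_def collinear_hypergraph_def)

  have l: "real r + 1 \<le> l" "ln q = l\<^sup>2"
  proof -
    show "real r + 1 \<le> l" unfolding l_def using q(2) by (rule real_le_rsqrt)
    have "0 \<le> ln (real q)" using q(2) zero_le_power2[of "real r + 1"] by linarith
    then show "ln q = l\<^sup>2" by (simp add: l_def)
  qed
  have l1: "1 \<le> l" using l(1) by linarith
  have s1: "1 \<le> s" using theta_pos by (simp add: s_def)
  have q_theta: "q\<^sup>2 \<le> \<theta>"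
    unfolding \<theta>_def using r member_le_sum[of 2 "{..<r}" "\<lambda>i. q ^ i"] by simp
  \<comment> \<open>The factor 2 is the same for all r, because \<theta> (q - 1) < q^r \<le> 2 (q -
    1) q^(r-1).\<close>
  have theta_le: "real \<theta> \<le> 2 * real q ^ (r - 1)"
  proof -
    have "\<theta> * (q - 1) + 1 = q * q ^ (r - 1)"
      using geometric_sum_nat[of q r] q(1) r by (simp add: \<theta>_def power_eq_if)
    also have "\<dots> \<le> 2 * (q - 1) * q ^ (r - 1)"
      using q(1) by (intro mult_right_mono) auto
    also have "\<dots> = 2 * q ^ (r - 1) * (q - 1)" by (simp only: mult_ac)
    finally have "\<theta> * (q - 1) \<le> 2 * q ^ (r - 1) * (q - 1)" by linarith
    then have "\<theta> \<le> 2 * q ^ (r - 1)" using q(1) by simp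
    then show ?thesis using of_nat_mono[of \<theta> "2 * q ^ (r - 1)", where 'a = real] by simp
  qed
  have s_le: "s \<le> 2 * Q"
  proof -
    have "Q\<^sup>2 = real q powr (real r - 1)"
      unfolding Q_def by (simp add: power2_eq_square flip: powr_add)
    also have "\<dots> = real q ^ (r - 1)"
      using r q(1) powr_realpow[of "real q" "r - 1"] by (simp add: of_nat_diff)
    finally have "real \<theta> \<le> (2 * Q)\<^sup>2"
      using theta_le zero_le_power2[of Q] by (simp add: power_mult_distrib)
    then show ?thesis
      unfolding s_def by (intro real_le_lsqrt) (auto simp: Q_def)
  qed
  have Q: "0 \<le> Q" by (simp add: Q_def)
  have K_le: "K + 1 \<le> c * Q * l"
  proof -
    have "s \<le> s * l" "1 \<le> s * l"
      using mult_mono[of 1 s 1 l] mult_left_mono[of 1 l s] s1 l1 by simp_all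
    then have "K + 1 \<le> 615612 * (s * l)" unfolding K_def by linarith
    also have "\<dots> \<le> 615612 * (2 * Q * l)"
      using s_le l1 by (intro mult_left_mono mult_right_mono) auto
    finally show ?thesis by (simp add: c_def)
  qed
  have K0: "0 \<le> K" using s1 l1 by (simp add: K_def)

  have cont: "container cap {} ?V (\<lambda>D. card (triples D) \<le> 4 * \<theta>\<^sup>2) K"
    using container_caps[OF q(1) q_theta] unfolding K_def s_def l_def .
  obtain f where f:
    "\<And>I. cap I \<Longrightarrow> {} \<subseteq> I \<Longrightarrow> I \<subseteq> ?V \<Longrightarrow> I \<subseteq> f I"
    "\<And>I. cap I \<Longrightarrow> {} \<subseteq> I \<Longrightarrow> I \<subseteq> ?V \<Longrightarrow> f I \<subseteq> ?V"
    "\<And>I. cap I \<Longrightarrow> {} \<subseteq> I \<Longrightarrow> I \<subseteq> ?V \<Longrightarrow> card (triples (f I)) \<le> 4 * \<theta>\<^sup>2"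
    "\<And>I. cap I \<Longrightarrow> {} \<subseteq> I \<Longrightarrow> I \<subseteq> ?V \<Longrightarrow> \<exists>S\<subseteq>I. finite S \<and>
       real (card S) \<le> K \<and> (\<forall>J. S \<union> {} \<subseteq> J \<and> J \<subseteq> I \<longrightarrow> f J = f I)"
    by (rule containerE[OF cont], rule that)
  \<comment> \<open>Small sets with an admissible image keep it, and all others are sent to the
    empty container. So \<open>b\<close> is defined on the whole power set and takes few values,
    however \<open>f\<close> behaves on sets that are not fingerprints.\<close>
  define good where
    "good S \<longleftrightarrow> card S \<le> k \<and> f S \<subseteq> ?V \<and> card (triples (f S)) \<le> 4 * \<theta>\<^sup>2" for S
  define b where "b S = (if good S then f S else {})" for S
  define \<C> where "\<C> = b ` Pow ?V"

  have fingerprint: "\<exists>S\<subseteq>I. I \<subseteq> b S \<and> b S \<in> \<C> \<and> real (card S) \<le> c * Q * ln (real q)"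
    if I: "independent_set H I" for I
  proof -
    have IV: "I \<subseteq> ?V" using I V by (simp add: independent_set_def)
    have "\<not> col x y z" if "x \<in> I" "y \<in> I" "z \<in> I" for x y z
    proof
      assume xyz: "col x y z"
      then obtain m where m: "m \<in> pg_lines F r" "{x, y, z} \<subseteq> m" "card {x, y, z} = 3"
        unfolding col_def by (auto simp: card_3_iff)
      moreover have "{x, y, z} \<subseteq> ?V" using m(1,2) pg_line_subset by (meson subset_trans)
      ultimately have "{x, y, z} \<in> hyperedges H"
        unfolding H_def collinear_hypergraph_def hypergraph.select_convs mem_Collect_eq by blast
      moreover have "{x, y, z} \<subseteq> I" using that by simp
      ultimately show False using I unfolding independent_set_def by blast
    qed
    then have cap: "cap I" using IV unfolding cap_def by simp
    obtain S where S: "S \<subseteq> I" "real (card S) \<le> K" "\<forall>J. S \<union> {} \<subseteq> J \<and> J \<subseteq> I \<longrightarrow> f J = f I"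
      using f(4)[OF cap empty_subsetI IV] by (elim exE conjE)
    \<comment> \<open>The choice J = S: the fingerprint determines the container without knowledge
      of \<open>I\<close>.\<close>
    have "f S = f I" using S(3)[rule_format, of S] S(1) by simp
    moreover have "card S \<le> k" using S(2) by (simp add: k_def le_nat_floor)
    ultimately have "b S = f I"
      using f(2,3)[OF cap empty_subsetI IV] by (simp add: b_def good_def)
    moreover have "b S \<in> \<C>" using S(1) IV unfolding \<C>_def by blast
    moreover have "real (card S) \<le> c * Q * ln (real q)"
    proof -
      have "l \<le> l\<^sup>2" using l1 by (simp add: power2_eq_square)
      then have "c * Q * l \<le> c * Q * l\<^sup>2" using Q by (intro mult_left_mono) (auto simp: c_def)
      then show ?thesis unfolding l(2) using S(2) K_le by linarith
    qed
    ultimately show ?thesis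
      using S(1) f(1)[OF cap empty_subsetI IV] by (intro exI[of _ S]) simp
  qed

  have \<C>_prop: "C \<subseteq> ?V \<and> card (triples C) \<le> 4 * \<theta>\<^sup>2" if "C \<in> \<C>" for C
    using that unfolding \<C>_def b_def good_def by (auto simp: triples_def)

  have edges: "real (num_hyperedges (induced_hypergraph H C)) \<le> 4 * (gauss_binomial_1 q r)\<^sup>2"
    if "C \<in> \<C>" for C
  proof -
    have fC: "finite C" using \<C>_prop[OF that] finite_V finite_subset by blast
    \<comment> \<open>A hyperedge arises from six ordered triples; one of them is enough for the
      bound.\<close>
    have "hyperedges (induced_hypergraph H C) \<subseteq> (\<lambda>(x, y, z). {x, y, z}) ` triples C"
    proof
      fix e assume "e \<in> hyperedges (induced_hypergraph H C)"
      then obtain m where e: "e \<subseteq> C" "card e = 3" "m \<in> pg_lines F r" "e \<subseteq> m"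
        by (auto simp: induced_hypergraph_def H_def collinear_hypergraph_def)
      then obtain x y z where xyz: "e = {x, y, z}" "x \<noteq> y" "x \<noteq> z" "y \<noteq> z"
        by (auto simp: card_3_iff)
      then have "col x y z" using e unfolding col_def by auto
      then have "(x, y, z) \<in> triples C"
        using e(1) xyz(1) by (auto simp: triples_def link_def)
      then show "e \<in> (\<lambda>(x, y, z). {x, y, z}) ` triples C"
        using xyz(1) by (force simp: image_iff)
    qed
    then have "num_hyperedges (induced_hypergraph H C) \<le> card ((\<lambda>(x, y, z). {x, y, z}) ` triples C)"
      unfolding num_hyperedges_def using finite_triples[OF fC] by (intro card_mono) auto
    also have "\<dots> \<le> card (triples C)"
      using finite_triples[OF fC] by (rule card_image_le)
    also have "\<dots> \<le> 4 * \<theta>\<^sup>2" using \<C>_prop[OF that] by simp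
    finally have "real (num_hyperedges (induced_hypergraph H C)) \<le> real (4 * \<theta>\<^sup>2)"
      by (rule of_nat_mono)
    also have "\<dots> = 4 * (gauss_binomial_1 q r)\<^sup>2"
      unfolding q_def gauss_binomial_1_eq by (simp add: \<theta>_def q_def)
    finally show ?thesis .
  qed

  have count: "ln (real (card \<C>)) \<le> c * Q * (ln (real q))\<^sup>2"
  proof -
    let ?N = "card ?V"
    let ?A = "{S. S \<subseteq> ?V \<and> card S \<le> k}"
    have fA: "finite ?A" using finite_V by (intro finite_subset[of ?A "Pow ?V"]) auto
    have N: "q \<le> ?N" "?N \<le> q ^ (r + 1)"
    proof -
      have "q \<le> q * \<theta>" using theta_pos by simp
      then show "q \<le> ?N" unfolding card_V by (rule trans_le_add1)
      have "?N = (\<Sum>i<r + 1. q ^ i)"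
        unfolding card_V \<theta>_def
        by (simp only: Suc_eq_plus1[symmetric] sum.lessThan_Suc_shift sum_distrib_left) simp
      moreover have "(\<Sum>i<r + 1. q ^ i) * 1 \<le> (\<Sum>i<r + 1. q ^ i) * (q - 1)"
        using q(1) by (intro mult_left_mono) auto
      ultimately show "?N \<le> q ^ (r + 1)"
        using geometric_sum_nat[of q "r + 1"] q(1) by linarith
    qed
    have "\<C> \<subseteq> insert {} (f ` ?A)"
      unfolding \<C>_def b_def good_def by auto
    then have "card \<C> \<le> card (insert {} (f ` ?A))"
      using fA by (intro card_mono) auto
    also have "\<dots> \<le> Suc (card (f ` ?A))"
      using fA by (simp add: card_insert_if)
    also have "\<dots> \<le> Suc (card ?A)" using fA by (simp add: card_image_le)
    also have "\<dots> \<le> 2 + ?N ^ k" using card_small_subsets[OF finite_V, of k] by simp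
    also have "\<dots> \<le> ?N * ?N ^ k"
    proof -
      have "1 \<le> ?N ^ k" using N(1) q(1) by simp
      moreover have "3 * ?N ^ k \<le> ?N * ?N ^ k" using N(1) q(1) by (intro mult_right_mono) auto
      ultimately show ?thesis by linarith
    qed
    also have "\<dots> = ?N ^ (k + 1)" by simp
    also have "\<dots> \<le> (q ^ (r + 1)) ^ (k + 1)" using N(2) by (rule power_mono) simp
    also have "\<dots> = q ^ ((r + 1) * (k + 1))" by (simp only: power_mult)
    finally have "card \<C> \<le> q ^ ((r + 1) * (k + 1))" .
    moreover have "0 < card \<C>" using finite_V by (auto simp: \<C>_def card_gt_0_iff)
    ultimately have "ln (real (card \<C>)) \<le> ln (real (q ^ ((r + 1) * (k + 1))))"
      by (intro ln_mono) (simp_all only: of_nat_0_less_iff of_nat_le_iff)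
    also have "\<dots> = real ((r + 1) * (k + 1)) * ln (real q)"
      unfolding of_nat_power by (rule ln_realpow)
    also have "\<dots> = (real r + 1) * (real k + 1) * l\<^sup>2"
      unfolding l(2) by (simp add: algebra_simps)
    \<comment> \<open>One factor l absorbs r + 1, one comes from the fingerprint, and l^2 is the
      logarithm of q. Together they are l^4 = (ln q)^2.\<close>
    also have "\<dots> \<le> l * (c * Q * l) * l\<^sup>2"
    proof (intro mult_right_mono mult_mono)
      have "real k \<le> K" using K0 unfolding k_def by linarith
      then show "real k + 1 \<le> c * Q * l" using K_le by linarith
    qed (use l l1 in auto)
    also have "\<dots> = c * Q * (ln (real q))\<^sup>2"
      by (simp add: l(2) power2_eq_square)
    finally show ?thesis .
  qed

  show ?thesis
    unfolding V Q_def[symmetric]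
  proof (intro exI conjI bexI[of _ b])
    show "\<C> \<subseteq> Pow ?V" using \<C>_prop by blast
    show "b \<in> Pow ?V \<rightarrow> \<C>" unfolding \<C>_def by blast
  qed (use fingerprint edges count in blast)+
qed

end

theorem theorem3p6:
  shows "\<exists>c1>0::real. \<exists>c2>0::real. \<forall>r\<ge>(3::nat). \<exists>q0::nat. \<forall>q\<ge>q0.
    \<forall>F::nat ring. field F \<and> finite (carrier F) \<and> card (carrier F) = q \<longrightarrow>
      (let H = collinear_hypergraph F r; V = vertices H in
       \<exists>\<C> \<subseteq> Pow V. \<exists>b \<in> Pow V \<rightarrow> \<C>.
         (\<forall>I. independent_set H I \<longrightarrow>
            (\<exists>S\<subseteq>I. I \<subseteq> b S \<and> b S \<in> \<C> \<and>
               real (card S) \<le> c1 * real q powr ((real r - 1) / 2) * ln (real q))) \<and>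
         (\<forall>C\<in>\<C>. real (num_hyperedges (induced_hypergraph H C)) \<le> 4 * (gauss_binomial_1 q r)\<^sup>2) \<and>
         ln (real (card \<C>)) \<le> c2 * real q powr ((real r - 1) / 2) * (ln (real q))\<^sup>2)"
  unfolding Let_def
proof (intro exI[of _ "1231224 :: real"] conjI allI impI)
  fix r :: nat assume r: "3 \<le> r"
  show "\<exists>q0::nat. \<forall>q\<ge>q0. \<forall>F::nat ring. field F \<and> finite (carrier F) \<and> card (carrier F) = q \<longrightarrow>
      (\<exists>\<C> \<subseteq> Pow (vertices (collinear_hypergraph F r)).
       \<exists>b \<in> Pow (vertices (collinear_hypergraph F r)) \<rightarrow> \<C>.
         (\<forall>I. independent_set (collinear_hypergraph F r) I \<longrightarrow>
            (\<exists>S\<subseteq>I. I \<subseteq> b S \<and> b S \<in> \<C> \<and>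
               real (card S) \<le> 1231224 * real q powr ((real r - 1) / 2) * ln (real q))) \<and>
         (\<forall>C\<in>\<C>. real (num_hyperedges (induced_hypergraph (collinear_hypergraph F r) C))
            \<le> 4 * (gauss_binomial_1 q r)\<^sup>2) \<and>
         ln (real (card \<C>)) \<le> 1231224 * real q powr ((real r - 1) / 2) * (ln (real q))\<^sup>2)"
  \<comment> \<open>The dependence on r is confined to this threshold, whose second part yields (r +
    1)^2 \<le> ln q.\<close>
  proof (intro exI[of _ "max 40000 (nat \<lceil>exp ((real r + 1)\<^sup>2)\<rceil>)"] allI impI)
    fix q :: nat and F :: "nat ring"
    assume q: "max 40000 (nat \<lceil>exp ((real r + 1)\<^sup>2)\<rceil>) \<le> q"
      and F: "field F \<and> finite (carrier F) \<and> card (carrier F) = q"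
    then interpret finite_field F
      by (simp add: finite_field_def finite_field_axioms_def)
    have "exp ((real r + 1)\<^sup>2) \<le> q" using q by (simp add: nat_ceiling_le_eq)
    then have "(real r + 1)\<^sup>2 \<le> ln q"
      using q by (subst ln_ge_iff) auto
    then show "\<exists>\<C> \<subseteq> Pow (vertices (collinear_hypergraph F r)).
       \<exists>b \<in> Pow (vertices (collinear_hypergraph F r)) \<rightarrow> \<C>.
         (\<forall>I. independent_set (collinear_hypergraph F r) I \<longrightarrow>
            (\<exists>S\<subseteq>I. I \<subseteq> b S \<and> b S \<in> \<C> \<and>
               real (card S) \<le> 1231224 * real q powr ((real r - 1) / 2) * ln (real q))) \<and>
         (\<forall>C\<in>\<C>. real (num_hyperedges (induced_hypergraph (collinear_hypergraph F r) C))
            \<le> 4 * (gauss_binomial_1 q r)\<^sup>2) \<and>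
         ln (real (card \<C>)) \<le> 1231224 * real q powr ((real r - 1) / 2) * (ln (real q))\<^sup>2"
      using containers_collinear[OF r] q F by simp
  qed
qed auto

end
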